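(* Let $k$ be a field of characteristic not $2$, let $B$ be a central division $k$-algebra of degree $n$ with unitary involution $\tau$, let $k_0$ be the fixed field of $\tau$ in $k$, and let $d\in k_0$ be such that $k=k_0(\sqrt{-d})$. Let $L_0$ be a maximal subfield of $\mathrm{Sym}(B,\tau)$ containing $k_0$. Assume that $L_0(\sqrt{-d})/k$ is Galois. If $\tau$ is positive at some ordering $P$ of $k_0$, then $L_0/k_0$ is Galois.
   Context: A central division $k$-algebra of degree $n$ is a division algebra with centre $k$ and $\dim_k B=n^2<\infty$. A unitary involution $\tau$ on $B$ is a ring anti-automorphism of $B$ with $\tau^2=\mathrm{id}$ whose restriction to the centre $k$ is nontrivial; with $k_0=\{x\in k:\tau(x)=x\}$, the extension $k/k_0$ is then quadratic, $\tau|_k$ is its unique nontrivial $k_0$-automorphism, and $\tau(\sqrt{-d})=-\sqrt{-d}$. $\mathrm{Sym}(B,\tau)=\{x\in B:\tau(x)=x\}$. A maximal subfield of $\mathrm{Sym}(B,\tau)$ containing $k_0$ is a subfield $L_0$ of $B$ with $k_0\subseteq L_0\subseteq \mathrm{Sym}(B,\tau)$ that is maximal with respect to inclusion among subfields of $B$ contained in $\mathrm{Sym}(B,\tau)$. Here $\sqrt{-d}\in k\subseteq B$, so $L_0(\sqrt{-d})$ is the subfield of $B$ generated by $L_0$ and $\sqrt{-d}$ (it contains $k$). Let $\mathrm{Trd}_B$ denote the reduced trace of $B$. The involution $\tau$ is positive (or positive definite) at an ordering $P$ of $k_0$ if the involution trace form $x\mapsto \mathrm{Trd}_B(\tau(x)x)$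 (which takes values in $k_0$) is positive definite at $P$, i.e. $\mathrm{Trd}_B(\tau(x)x)$ is strictly positive with respect to $P$ for every nonzero $x\in B$. *)

theory Defs
  imports "HOL-Algebra.Algebra"
begin

definition centre :: "('a, 'm) ring_scheme \<Rightarrow> 'a set" where
  "centre B = {z \<in> carrier B. \<forall>x \<in> carrier B. z \<otimes>\<^bsub>B\<^esub> x = x \<otimes>\<^bsub>B\<^esub> z}"

text \<open>The base field is identified with the centre of \<open>B\<close>; the library's \<open>ring\<close> is associative and
  unital but not assumed commutative.\<close>

locale central_division_algebra = ring B for B :: "('a, 'm) ring_scheme" (structure) +
  fixes n :: nat
  assumes one_not_zero: "\<one> \<noteq> \<zero>"
    and division: "Units B = carrier B - {\<zero>}"
    and dimension_centre: "dimension (n\<^sup>2) (centre B) (carrier B)"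

locale unitary_involution = ring B for B :: "('a, 'm) ring_scheme" (structure) +
  fixes \<tau> :: "'a \<Rightarrow> 'a"
  assumes closed: "x \<in> carrier B \<Longrightarrow> \<tau> x \<in> carrier B"
    and additive: "\<lbrakk>x \<in> carrier B; y \<in> carrier B\<rbrakk> \<Longrightarrow> \<tau> (x \<oplus> y) = \<tau> x \<oplus> \<tau> y"
    and anti_mult: "\<lbrakk>x \<in> carrier B; y \<in> carrier B\<rbrakk> \<Longrightarrow> \<tau> (x \<otimes> y) = \<tau> y \<otimes> \<tau> x"
    and unital: "\<tau> \<one> = \<one>"
    and involutive: "x \<in> carrier B \<Longrightarrow> \<tau> (\<tau> x) = x"
    and nontrivial_on_centre: "\<exists>z \<in> centre B. \<tau> z \<noteq> z"

definition Sym :: "('a, 'm) ring_scheme \<Rightarrow> ('a \<Rightarrow> 'a) \<Rightarrow> 'a set" where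
  "Sym B \<tau> = {x \<in> carrier B. \<tau> x = x}"

definition fixed_centre :: "('a, 'm) ring_scheme \<Rightarrow> ('a \<Rightarrow> 'a) \<Rightarrow> 'a set" where
  "fixed_centre B \<tau> = {x \<in> centre B. \<tau> x = x}"

definition maximal_symmetric_subfield ::
    "('a, 'm) ring_scheme \<Rightarrow> ('a \<Rightarrow> 'a) \<Rightarrow> 'a set \<Rightarrow> bool" where
  "maximal_symmetric_subfield B \<tau> L \<longleftrightarrow>
     subfield L B \<and> fixed_centre B \<tau> \<subseteq> L \<and> L \<subseteq> Sym B \<tau> \<and>
     (\<forall>M. subfield M B \<and> L \<subseteq> M \<and> M \<subseteq> Sym B \<tau> \<longrightarrow> M = L)"

text \<open>Galois extensions inside an ambient ring \<open>R\<close>: algebraic extensions \<open>L\<close> of \<open>K\<close> such that \<open>K\<close> is the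
  fixed field of the group of field automorphisms of \<open>L\<close> over \<open>K\<close>.\<close>

definition field_auts :: "('a, 'm) ring_scheme \<Rightarrow> 'a set \<Rightarrow> 'a set \<Rightarrow> ('a \<Rightarrow> 'a) set" where
  "field_auts R K L =
     {\<sigma> \<in> ring_iso (R\<lparr>carrier := L\<rparr>) (R\<lparr>carrier := L\<rparr>). \<forall>x \<in> K. \<sigma> x = x}"

definition galois_extension :: "('a, 'm) ring_scheme \<Rightarrow> 'a set \<Rightarrow> 'a set \<Rightarrow> bool" where
  "galois_extension R K L \<longleftrightarrow>
     subfield K R \<and> subfield L R \<and> K \<subseteq> L \<and>
     (\<forall>x \<in> L. (ring.algebraic R over K) x) \<and>
     {x \<in> L. \<forall>\<sigma> \<in> field_auts R K L. \<sigma> x = x} = K"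

text \<open>The ring of \<open>n \<times> n\<close> matrices over \<open>F\<close>; matrices are extensional functions on index pairs.\<close>

definition matrix_ring :: "('f, 'm) ring_scheme \<Rightarrow> nat \<Rightarrow> (nat \<times> nat \<Rightarrow> 'f) ring" where
  "matrix_ring F n =
     \<lparr> carrier = {..<n} \<times> {..<n} \<rightarrow>\<^sub>E carrier F,
       monoid.mult = (\<lambda>A A'. \<lambda>(i, j) \<in> {..<n} \<times> {..<n}. \<Oplus>\<^bsub>F\<^esub>l \<in> {..<n}. A (i, l) \<otimes>\<^bsub>F\<^esub> A' (l, j)),
       one = (\<lambda>(i, j) \<in> {..<n} \<times> {..<n}. if i = j then \<one>\<^bsub>F\<^esub> else \<zero>\<^bsub>F\<^esub>),
       ring.zero = (\<lambda>(i, j) \<in> {..<n} \<times> {..<n}. \<zero>\<^bsub>F\<^esub>),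
       ring.add = (\<lambda>A A'. \<lambda>(i, j) \<in> {..<n} \<times> {..<n}. A (i, j) \<oplus>\<^bsub>F\<^esub> A' (i, j)) \<rparr>"

definition scalar_matrix :: "('f, 'm) ring_scheme \<Rightarrow> nat \<Rightarrow> 'f \<Rightarrow> (nat \<times> nat \<Rightarrow> 'f)" where
  "scalar_matrix F n c = (\<lambda>(i, j) \<in> {..<n} \<times> {..<n}. if i = j then c else \<zero>\<^bsub>F\<^esub>)"

definition matrix_trace :: "('f, 'm) ring_scheme \<Rightarrow> nat \<Rightarrow> (nat \<times> nat \<Rightarrow> 'f) \<Rightarrow> 'f" where
  "matrix_trace F n A = (\<Oplus>\<^bsub>F\<^esub>i \<in> {..<n}. A (i, i))"

text \<open>A splitting of \<open>B\<close> over an extension \<open>\<iota> : k \<rightarrow> F\<close> of its centre \<open>k\<close> is an isomorphism of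
  \<open>F\<close>-algebras from \<open>B \<otimes>\<^sub>k F\<close> to the \<open>n \<times> n\<close> matrices over \<open>F\<close>. It is given here by its restriction
  \<open>\<rho>\<close> to \<open>B\<close>: a ring homomorphism that is \<open>k\<close>-linear and whose \<open>F\<close>-linear extension is bijective,
  i.e. which sends a \<open>k\<close>-basis of \<open>B\<close> to an \<open>F\<close>-basis of the matrix ring.\<close>

definition splitting ::
    "('a, 'm) ring_scheme \<Rightarrow> nat \<Rightarrow> 'f ring \<Rightarrow> ('a \<Rightarrow> 'f) \<Rightarrow> ('a \<Rightarrow> nat \<times> nat \<Rightarrow> 'f) \<Rightarrow> bool" where
  "splitting B n F \<iota> \<rho> \<longleftrightarrow>
     field F \<and> \<iota> \<in> ring_hom (B\<lparr>carrier := centre B\<rparr>) F \<and>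
     \<rho> \<in> ring_hom B (matrix_ring F n) \<and>
     (\<forall>z \<in> centre B. \<rho> z = scalar_matrix F n (\<iota> z)) \<and>
     (\<exists>bs. set bs \<subseteq> carrier B \<and>
        ring.independent B (centre B) bs \<and> ring.Span B (centre B) bs = carrier B \<and>
        ring.independent (matrix_ring F n) (scalar_matrix F n ` carrier F) (map \<rho> bs) \<and>
        ring.Span (matrix_ring F n) (scalar_matrix F n ` carrier F) (map \<rho> bs)
          = carrier (matrix_ring F n))"

text \<open>The reduced trace of \<open>b\<close> is the trace of the matrix of \<open>b\<close> under a splitting. It lies in the centre
  and depends neither on the splitting field nor on the isomorphism. Splitting fields with carrier
  in the type of \<open>B\<close> suffice, since any maximal subfield of \<open>B\<close> is one.\<close>

definition reduced_trace :: "('a, 'm) ring_scheme \<Rightarrow> nat \<Rightarrow> 'a \<Rightarrow> 'a" where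
  "reduced_trace B n b =
     (THE c. c \<in> centre B \<and>
        (\<exists>(F :: 'a ring) \<iota> \<rho>. splitting B n F \<iota> \<rho> \<and> \<iota> c = matrix_trace F n (\<rho> b)))"

text \<open>Orderings are given by their cones of nonnegative elements; \<open>x\<close> is strictly positive with
  respect to \<open>P\<close> iff \<open>x \<in> P - {0}\<close>.\<close>

definition field_ordering :: "('a, 'm) ring_scheme \<Rightarrow> 'a set \<Rightarrow> 'a set \<Rightarrow> bool" where
  "field_ordering R K P \<longleftrightarrow>
     P \<subseteq> K \<and>
     (\<forall>x \<in> P. \<forall>y \<in> P. x \<oplus>\<^bsub>R\<^esub> y \<in> P \<and> x \<otimes>\<^bsub>R\<^esub> y \<in> P) \<and>
     (\<forall>x \<in> K. x \<in> P \<or> \<ominus>\<^bsub>R\<^esub> x \<in> P) \<and>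
     (\<forall>x \<in> P. \<ominus>\<^bsub>R\<^esub> x \<in> P \<longrightarrow> x = \<zero>\<^bsub>R\<^esub>)"

definition positive_involution ::
    "('a, 'm) ring_scheme \<Rightarrow> nat \<Rightarrow> ('a \<Rightarrow> 'a) \<Rightarrow> 'a set \<Rightarrow> bool" where
  "positive_involution B n \<tau> P \<longleftrightarrow>
     (\<forall>x \<in> carrier B - {\<zero>\<^bsub>B\<^esub>}. reduced_trace B n (\<tau> x \<otimes>\<^bsub>B\<^esub> x) \<in> P - {\<zero>\<^bsub>B\<^esub>})"

end

theory Submission
  imports Defs
begin

text \<open>
  Put \<open>L = L\<^sub>0(s)\<close>. Maximality of \<open>L\<^sub>0\<close> makes \<open>L\<close> its own centralizer in \<open>B\<close>, so right multiplication
  of \<open>B\<close> on the left \<open>L\<close>-space \<open>B\<close> splits \<open>B\<close>, and every automorphism of \<open>L/k\<close> is induced by an inner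
  automorphism of \<open>B\<close>. Hence the reduced trace is invariant under \<open>Gal(L/k)\<close> on \<open>L\<close>. For \<open>\<phi> \<in> Gal(L/k)\<close>
  the involutions \<open>\<tau>\<close> and \<open>\<phi>\<inverse> \<tau> \<phi>\<close> of \<open>L\<close> are both positive and agree on \<open>k\<close>; their quotient is an
  automorphism \<open>\<psi>\<close> of finite order all of whose powers are positive definite for the form \<open>Trd(\<tau>(x) y)\<close>.
  As \<open>\<Sum> \<psi>\<^sup>j\<close> over a period kills \<open>y = x - \<psi>(x)\<close>, positivity gives \<open>y = 0\<close>. Thus \<open>\<tau>\<close> commutes with \<open>Gal(L/k)\<close>,
  which therefore acts on \<open>L\<^sub>0\<close>, with fixed field \<open>k \<inter> L\<^sub>0 = k\<^sub>0\<close>.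
\<close>

section \<open>Division rings\<close>

text \<open>\<open>reduced_trace\<close> is a definite description over all splittings whose field
  has its elements in the type of \<open>B\<close>. Before positivity says anything, one splitting
  must be exhibited and all of them must be shown to give the same value. No two splittings are
  compared by an isomorphism: positivity is only tested at elements of \<open>L\<close>, and there
  any splitting satisfies \<open>m * Trd(l) = n * T(l)\<close>, with \<open>m\<close> the order of
  \<open>Gal(L/k)\<close> and \<open>T(l)\<close> the sum of the conjugates of \<open>l\<close>. The
  reason is that conjugate elements have equal matrix traces and central elements become scalar.
  Dividing by \<open>m\<close> needs characteristic 0, which the ordering supplies.

  One device, the operators sending \<open>x\<close> to a sum of terms \<open>l x b\<close> with
  \<open>l\<close> in \<open>L\<close>, serves twice. They interpolate arbitrary values on an
  \<open>L\<close>-basis and determine their coefficients relative to a central basis, which gives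
  the splitting; and twisting \<open>l\<close> by an embedding is well defined, which gives
  Skolem-Noether. Finiteness of the Galois group, needed for \<open>T\<close> and for the finite
  order of \<psi>, follows from the independence over \<open>L\<close> of the conjugating
  elements.\<close>

locale skew_field = ring R for R (structure) +
  assumes one_neq_zero [simp]: "\<one> \<noteq> \<zero>"
    and Units_eq: "Units R = carrier R - {\<zero>}"
begin

lemma inv_simps [simp]:
  assumes "x \<in> carrier R" "x \<noteq> \<zero>"
  shows "inv x \<in> carrier R" "inv x \<otimes> x = \<one>" "x \<otimes> inv x = \<one>" "inv x \<noteq> \<zero>"
proof -
  have u: "x \<in> Units R" using assms Units_eq by simp
  show "inv x \<in> carrier R" "inv x \<otimes> x = \<one>" "x \<otimes> inv x = \<one>" using u by simp_all
  show "inv x \<noteq> \<zero>" using u Units_inv_Units[OF u] Units_eq by blast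
qed

lemma inv_cancel [simp]:
  assumes "x \<in> carrier R" "x \<noteq> \<zero>" "y \<in> carrier R"
  shows "inv x \<otimes> (x \<otimes> y) = y" "x \<otimes> (inv x \<otimes> y) = y"
    "y \<otimes> x \<otimes> inv x = y" "y \<otimes> inv x \<otimes> x = y"
proof -
  show "inv x \<otimes> (x \<otimes> y) = y" "x \<otimes> (inv x \<otimes> y) = y"
    using assms m_assoc[of "inv x" x y] m_assoc[of x "inv x" y] by simp_all
  show "y \<otimes> x \<otimes> inv x = y" "y \<otimes> inv x \<otimes> x = y"
    using assms m_assoc[of y x "inv x"] m_assoc[of y "inv x" x] by simp_all
qed

lemma mult_eq_zero_iff [simp]:
  assumes "x \<in> carrier R" "y \<in> carrier R"
  shows "x \<otimes> y = \<zero> \<longleftrightarrow> x = \<zero> \<or> y = \<zero>"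
  using assms inv_cancel(1)[of x y] inv_simps(1)[of x] by fastforce

lemma inv_unique_left:
  assumes "x \<in> carrier R" "y \<in> carrier R" "y \<otimes> x = \<one>"
  shows "y = inv x"
proof -
  have "x \<noteq> \<zero>" using assms one_neq_zero r_null by metis
  then have "y \<otimes> x \<otimes> inv x = y" using assms by (intro inv_cancel)
  then have "\<one> \<otimes> inv x = y" unfolding assms(3) .
  then show ?thesis using assms \<open>x \<noteq> \<zero>\<close> by simp
qed

lemma inv_commute:
  assumes "x \<in> carrier R" "x \<noteq> \<zero>" "y \<in> carrier R" "x \<otimes> y = y \<otimes> x"
  shows "inv x \<otimes> y = y \<otimes> inv x"
proof -
  have "inv x \<otimes> y = inv x \<otimes> (y \<otimes> x) \<otimes> inv x" using assms by (simp add: m_assoc)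
  also have "\<dots> = y \<otimes> inv x" using assms(1-3) assms(4)[symmetric] by simp
  finally show ?thesis .
qed

lemma subfieldI_commute:
  assumes "subring K R" and comm: "\<And>x y. x \<in> K \<Longrightarrow> y \<in> K \<Longrightarrow> x \<otimes> y = y \<otimes> x"
    and inv: "\<And>x. x \<in> K \<Longrightarrow> x \<noteq> \<zero> \<Longrightarrow> inv x \<in> K"
  shows "subfield K R"
proof (rule subfieldI)
  show "subcring K R" using subcringI[OF assms(1)] comm by blast
  have K: "K \<subseteq> carrier R" using subringE(1)[OF assms(1)] .
  show "Units (R\<lparr>carrier := K\<rparr>) = K - {\<zero>}"
  proof
    show "Units (R\<lparr>carrier := K\<rparr>) \<subseteq> K - {\<zero>}"
      unfolding Units_def using K one_neq_zero[symmetric] by (auto simp: subset_iff)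
    show "K - {\<zero>} \<subseteq> Units (R\<lparr>carrier := K\<rparr>)"
    proof
      fix x assume x: "x \<in> K - {\<zero>}"
      then have "x \<in> carrier R" using K by blast
      with x show "x \<in> Units (R\<lparr>carrier := K\<rparr>)"
        unfolding Units_def using inv[of x] inv_simps[of x] by force
    qed
  qed
qed

lemma subfieldD:
  assumes "subfield K R"
  shows "K \<subseteq> carrier R" "\<zero> \<in> K" "\<one> \<in> K" "\<And>x. x \<in> K \<Longrightarrow> x \<in> carrier R"
    "\<And>x. x \<in> K \<Longrightarrow> \<ominus> x \<in> K"
    "\<And>x y. x \<in> K \<Longrightarrow> y \<in> K \<Longrightarrow> x \<oplus> y \<in> K" "\<And>x y. x \<in> K \<Longrightarrow> y \<in> K \<Longrightarrow> x \<ominus> y \<in> K"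
    "\<And>x y. x \<in> K \<Longrightarrow> y \<in> K \<Longrightarrow> x \<otimes> y \<in> K"
    "\<And>x y. x \<in> K \<Longrightarrow> y \<in> K \<Longrightarrow> x \<otimes> y = y \<otimes> x"
    "\<And>x. x \<in> K \<Longrightarrow> x \<noteq> \<zero> \<Longrightarrow> inv x \<in> K"
  using subringE[OF subfieldE(1)[OF assms]] subfieldE[OF assms] subfield_m_inv(1)[OF assms]
  by (auto simp: a_minus_def)

lemma add_pow_subfield: "subfield K R \<Longrightarrow> x \<in> K \<Longrightarrow> add_pow R (n::nat) x \<in> K"
  by (induction n) (simp_all add: subfieldD)

lemma centre_subfield: "subfield (centre R) R"
proof (rule subfieldI_commute)
  show "subring (centre R) R"
  proof (rule subringI)
    fix x y assume "x \<in> centre R" "y \<in> centre R"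
    then have x: "x \<in> carrier R" "y \<in> carrier R"
      and c: "\<And>z. z \<in> carrier R \<Longrightarrow> x \<otimes> z = z \<otimes> x" "\<And>z. z \<in> carrier R \<Longrightarrow> y \<otimes> z = z \<otimes> y"
      by (auto simp: centre_def)
    show "x \<oplus> y \<in> centre R" using x c by (simp add: centre_def l_distr r_distr)
    have "x \<otimes> y \<otimes> z = z \<otimes> (x \<otimes> y)" if z: "z \<in> carrier R" for z
    proof -
      have "x \<otimes> y \<otimes> z = x \<otimes> z \<otimes> y" using x z c(2)[OF z] by (simp add: m_assoc)
      then show ?thesis using x z c(1)[OF z] by (simp add: m_assoc)
    qed
    then show "x \<otimes> y \<in> centre R" using x by (simp add: centre_def)
  qed (auto simp: centre_def l_minus r_minus)
next
  fix x assume "x \<in> centre R" "x \<noteq> \<zero>"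
  then have "x \<in> carrier R" "\<And>y. y \<in> carrier R \<Longrightarrow> x \<otimes> y = y \<otimes> x" by (auto simp: centre_def)
  with \<open>x \<noteq> \<zero>\<close> have "inv x \<in> carrier R" "\<forall>y\<in>carrier R. inv x \<otimes> y = y \<otimes> inv x"
    using inv_commute inv_simps(1) by blast+
  then show "inv x \<in> centre R" unfolding centre_def by blast
qed (unfold centre_def, blast)

lemma centre_commute: "z \<in> centre R \<Longrightarrow> x \<in> carrier R \<Longrightarrow> z \<otimes> x = x \<otimes> z"
  unfolding centre_def by blast

lemma combine_map_closed:
  "\<lbrakk>\<And>l. l \<in> set ls \<Longrightarrow> f l \<in> carrier R; set bs \<subseteq> carrier R\<rbrakk> \<Longrightarrow> combine (map f ls) bs \<in> carrier R"
  by (rule combine_in_carrier) auto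

lemma combine_map_minus:
  assumes "\<And>l. l \<in> set ls \<Longrightarrow> f l \<in> carrier R" "\<And>l. l \<in> set ls \<Longrightarrow> g l \<in> carrier R"
    "set bs \<subseteq> carrier R"
  shows "combine (map (\<lambda>l. f l \<ominus> g l) ls) bs = combine (map f ls) bs \<ominus> combine (map g ls) bs"
  using assms
proof (induction ls arbitrary: bs)
  case (Cons l ls)
  show ?case
  proof (cases bs)
    case (Cons b bs')
    have [simp]: "f l \<in> carrier R" "g l \<in> carrier R" "b \<in> carrier R"
      "combine (map f ls) bs' \<in> carrier R" "combine (map g ls) bs' \<in> carrier R"
      using Cons.prems Cons by (auto intro!: combine_map_closed)
    have "combine (map (\<lambda>l. f l \<ominus> g l) ls) bs' = combine (map f ls) bs' \<ominus> combine (map g ls) bs'"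
      using Cons.IH[of bs'] Cons.prems Cons by simp
    then show ?thesis using Cons
      by (simp add: a_minus_def l_distr l_minus minus_add a_ac)
  qed (simp add: a_minus_def)
qed (simp add: a_minus_def)

lemma combine_map_mult:
  assumes "\<And>l. l \<in> set ls \<Longrightarrow> f l \<in> carrier R" "set bs \<subseteq> carrier R" "c \<in> carrier R"
  shows "combine (map (\<lambda>l. c \<otimes> f l) ls) bs = c \<otimes> combine (map f ls) bs"
  by (subst combine_r_distr) (use assms in \<open>auto simp: comp_def\<close>)

text \<open>Injectivity of \<open>R \<otimes> R \<rightarrow> End R\<close> over the centre: after normalizing the first coefficient to
  \<open>1\<close>, substituting \<open>y x\<close> for \<open>x\<close> eliminates the first term.\<close>

lemma combine_central_zero:
  assumes "independent (centre R) bs" "length ls = length bs" "set ls \<subseteq> carrier R"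
    and "\<And>x. x \<in> carrier R \<Longrightarrow> combine (map (\<lambda>l. l \<otimes> x) ls) bs = \<zero>"
  shows "set ls \<subseteq> {\<zero>}"
  using assms
proof (induction bs arbitrary: ls rule: list.induct)
  case (Cons b bs)
  then obtain l ls' where ls: "ls = l # ls'" and len: "length ls' = length bs"
    by (auto simp: length_Suc_conv)
  have ind: "independent (centre R) bs" and b: "b \<in> carrier R" "b \<notin> Span (centre R) bs"
    using independent_backwards[OF Cons.prems(1)] by auto
  have bs: "set bs \<subseteq> carrier R" using independent_in_carrier[OF ind] .
  have l: "l \<in> carrier R" and ls': "set ls' \<subseteq> carrier R" using Cons.prems(3) ls by auto
  have eq: "l \<otimes> x \<otimes> b \<oplus> combine (map (\<lambda>l. l \<otimes> x) ls') bs = \<zero>" if "x \<in> carrier R" for x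
    using Cons.prems(4)[OF that] ls by simp
  have "l = \<zero>"
  proof (rule ccontr)
    assume l0: "l \<noteq> \<zero>"
    define ms where "ms = map ((\<otimes>) (inv l)) ls'"
    have ms: "set ms \<subseteq> carrier R" "length ms = length bs"
      using l l0 ls' len by (auto simp: ms_def)
    have cl: "combine (map (\<lambda>m. m \<otimes> x) ms) bs \<in> carrier R" if "x \<in> carrier R" for x
      using ms bs that by (intro combine_map_closed) auto
    have eq1: "x \<otimes> b \<oplus> combine (map (\<lambda>m. m \<otimes> x) ms) bs = \<zero>" if x: "x \<in> carrier R" for x
    proof -
      have c: "combine (map (\<lambda>l. l \<otimes> x) ls') bs \<in> carrier R"
        using ls' x bs by (intro combine_map_closed) auto
      have "map (\<lambda>m. m \<otimes> x) ms = map (\<lambda>m. inv l \<otimes> (m \<otimes> x)) ls'"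
        using ls' l l0 x by (auto simp: ms_def m_assoc)
      then have "x \<otimes> b \<oplus> combine (map (\<lambda>m. m \<otimes> x) ms) bs
          = inv l \<otimes> (l \<otimes> x \<otimes> b \<oplus> combine (map (\<lambda>l. l \<otimes> x) ls') bs)"
        using combine_map_mult[of ls' "\<lambda>m. m \<otimes> x" bs "inv l", OF _ bs] ls' l l0 x bs b(1) c
        by (simp add: r_distr m_assoc subset_iff)
      then show ?thesis using eq[OF x] l l0 by simp
    qed
    have central: "m \<in> centre R" if m: "m \<in> set ms" for m
    proof -
      have "m \<otimes> y = y \<otimes> m" if y: "y \<in> carrier R" for y
      proof -
        \<comment> \<open>The relation at \<open>y \<otimes> x\<close> minus \<open>y\<close> times
          the relation at \<open>x\<close> has no \<open>b\<close> term, and its coefficients are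
          commutators with \<open>y\<close>; the induction hypothesis kills them.\<close>
        have "set (map (\<lambda>m. m \<otimes> y \<ominus> y \<otimes> m) ms) \<subseteq> {\<zero>}"
        proof (rule Cons.IH[OF ind])
          fix x assume x: "x \<in> carrier R"
          have "combine (map (\<lambda>m. m \<otimes> (y \<otimes> x) \<ominus> y \<otimes> (m \<otimes> x)) ms) bs
              = combine (map (\<lambda>m. m \<otimes> (y \<otimes> x)) ms) bs \<ominus> y \<otimes> combine (map (\<lambda>m. m \<otimes> x) ms) bs"
            using ms bs x y by (subst combine_map_minus) (simp_all add: combine_map_mult subset_iff)
          also have "\<dots> = (y \<otimes> x \<otimes> b \<oplus> combine (map (\<lambda>m. m \<otimes> (y \<otimes> x)) ms) bs)
              \<ominus> y \<otimes> (x \<otimes> b \<oplus> combine (map (\<lambda>m. m \<otimes> x) ms) bs)"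
            using cl[OF x] cl[of "y \<otimes> x"] x y b(1)
            by (simp add: r_distr m_assoc a_minus_def minus_add a_ac r_neg2)
          also have "\<dots> = \<zero>" using eq1[OF x] eq1[of "y \<otimes> x"] x y by (simp add: a_minus_def)
          also have "map (\<lambda>m. m \<otimes> (y \<otimes> x) \<ominus> y \<otimes> (m \<otimes> x)) ms
              = map (\<lambda>l. l \<otimes> x) (map (\<lambda>m. m \<otimes> y \<ominus> y \<otimes> m) ms)"
            using ms x y by (auto simp: a_minus_def l_distr l_minus m_assoc)
          finally show "combine (map (\<lambda>l. l \<otimes> x) (map (\<lambda>m. m \<otimes> y \<ominus> y \<otimes> m) ms)) bs = \<zero>" .
        qed (use ms y in auto)
        then have "m \<otimes> y \<ominus> y \<otimes> m = \<zero>" using m by auto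
        moreover have "m \<in> carrier R" using m ms by blast
        ultimately show ?thesis using y by (simp add: r_right_minus_eq)
      qed
      then show ?thesis using m ms unfolding centre_def by blast
    qed
    \<comment> \<open>At \<open>x = \<one>\<close> the relation becomes a dependence over the centre
      in which \<open>b\<close> has coefficient 1.\<close>
    have "combine (\<one> # ms) (b # bs) = \<zero>"
    proof -
      have "map (\<lambda>m. m \<otimes> \<one>) ms = ms" using ms by (auto intro!: map_idI)
      then show ?thesis using eq1[of \<one>] b by simp
    qed
    moreover have "set ms \<subseteq> centre R" using central by blast
    moreover have "\<one> \<in> centre R - {\<zero>}" by (auto simp: centre_def)
    ultimately have "b \<in> Span (centre R) bs"
      using Span_mem_iff[OF centre_subfield bs b(1)] by blast
    with b(2) show False by simp
  qed
  moreover have "set ls' \<subseteq> {\<zero>}"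
  proof (rule Cons.IH[OF ind len ls'])
    fix x assume x: "x \<in> carrier R"
    have "combine (map (\<lambda>l. l \<otimes> x) ls') bs \<in> carrier R"
      using ls' x bs by (intro combine_map_closed) auto
    then show "combine (map (\<lambda>l. l \<otimes> x) ls') bs = \<zero>" using eq[OF x] x b \<open>l = \<zero>\<close> by simp
  qed
  ultimately show ?case using ls by simp
qed simp

end

section \<open>Density and the Skolem--Noether theorem\<close>

context ring
begin

lemma combine_all_zero:
  assumes "set ls \<subseteq> {\<zero>}" "set bs \<subseteq> carrier R"
  shows "combine ls bs = \<zero>"
  using assms by (induction ls bs rule: combine.induct) auto

lemma combine_zero_vectors:
  fixes us :: "'a list"
  assumes "set ks \<subseteq> carrier R"
  shows "combine ks (map (\<lambda>_. \<zero>) us) = \<zero>"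
  using assms by (induction ks us rule: combine.induct) auto

lemma map_map2_add:
  assumes "\<And>x y. x \<in> A \<Longrightarrow> y \<in> A \<Longrightarrow> f (x \<oplus> y) = f x \<oplus> f y" "set xs \<subseteq> A" "set ys \<subseteq> A"
  shows "map f (map2 (\<oplus>) xs ys) = map2 (\<oplus>) (map f xs) (map f ys)"
  using assms by (induction xs ys rule: list_induct2') auto

end

section \<open>Operators coming from L tensor R, and their twists\<close>

text \<open>Instantiated in two ways: with the identity, to build the splitting, and with an
  automorphism of \<open>L\<close> over the centre, to realize it by conjugation.\<close>

locale skew_field_embedding = skew_field +
  fixes L :: "'a set" and \<sigma> :: "'a \<Rightarrow> 'a"
  assumes L_subfield: "subfield L R" and centre_subset: "centre R \<subseteq> L"
    and \<sigma>_closed: "l \<in> L \<Longrightarrow> \<sigma> l \<in> carrier R"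
    and \<sigma>_add: "\<lbrakk>l \<in> L; l' \<in> L\<rbrakk> \<Longrightarrow> \<sigma> (l \<oplus> l') = \<sigma> l \<oplus> \<sigma> l'"
    and \<sigma>_mult: "\<lbrakk>l \<in> L; l' \<in> L\<rbrakk> \<Longrightarrow> \<sigma> (l \<otimes> l') = \<sigma> l \<otimes> \<sigma> l'"
    and \<sigma>_centre: "z \<in> centre R \<Longrightarrow> \<sigma> z = z"
begin

text \<open>The action of an element of \<open>L \<otimes> R\<close> on \<open>R\<close>, together with its twist by \<open>\<sigma>\<close>. The last rule makes
  the relation insensitive to values outside the carrier.\<close>

inductive tensor_op :: "('a \<Rightarrow> 'a) \<Rightarrow> ('a \<Rightarrow> 'a) \<Rightarrow> bool" where
  pure: "\<lbrakk>l \<in> L; b \<in> carrier R\<rbrakk> \<Longrightarrow> tensor_op (\<lambda>x. l \<otimes> x \<otimes> b) (\<lambda>x. \<sigma> l \<otimes> x \<otimes> b)"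
| plus: "\<lbrakk>tensor_op f g; tensor_op f' g'\<rbrakk> \<Longrightarrow> tensor_op (\<lambda>x. f x \<oplus> f' x) (\<lambda>x. g x \<oplus> g' x)"
| agree: "\<lbrakk>tensor_op f g; \<And>x. x \<in> carrier R \<Longrightarrow> f' x = f x; \<And>x. x \<in> carrier R \<Longrightarrow> g' x = g x\<rbrakk>
    \<Longrightarrow> tensor_op f' g'"

lemmas LD = subfieldD[OF L_subfield]

lemma centre_in_L: "z \<in> centre R \<Longrightarrow> z \<in> L"
  using centre_subset by blast

lemma one_centre: "\<one> \<in> centre R" and minus_one_centre: "\<ominus> \<one> \<in> centre R"
  using subfieldD(3,5)[OF centre_subfield] by auto

lemma tensor_op_closed:
  assumes "tensor_op f g" "x \<in> carrier R"
  shows "f x \<in> carrier R" "g x \<in> carrier R"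
  using assms by (induction rule: tensor_op.induct) (auto simp: LD \<sigma>_closed)

lemma tensor_op_left:
  assumes "tensor_op f g" "l \<in> L"
  shows "tensor_op (\<lambda>x. l \<otimes> f x) (\<lambda>x. \<sigma> l \<otimes> g x)"
  using assms(1)
proof (induction rule: tensor_op.induct)
  case (pure l' b)
  show ?case
    by (rule tensor_op.agree[OF tensor_op.pure[of "l \<otimes> l'" b]])
      (use pure assms(2) in \<open>auto simp: LD \<sigma>_closed \<sigma>_mult m_assoc\<close>)
next
  case (plus f g f' g')
  show ?case
    by (rule tensor_op.agree[OF tensor_op.plus[OF plus.IH]])
      (use plus.hyps assms(2) tensor_op_closed in \<open>simp_all add: LD \<sigma>_closed r_distr\<close>)
qed (rule tensor_op.agree, auto)

lemma tensor_op_right: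
  assumes "tensor_op f g" "b \<in> carrier R"
  shows "tensor_op (\<lambda>x. f x \<otimes> b) (\<lambda>x. g x \<otimes> b)"
  using assms(1)
proof (induction rule: tensor_op.induct)
  case (pure l b')
  show ?case
    by (rule tensor_op.agree[OF tensor_op.pure[of l "b' \<otimes> b"]])
      (use pure assms(2) in \<open>auto simp: LD \<sigma>_closed m_assoc\<close>)
next
  case (plus f g f' g')
  show ?case
    by (rule tensor_op.agree[OF tensor_op.plus[OF plus.IH]])
      (use plus.hyps assms(2) tensor_op_closed in \<open>simp_all add: l_distr\<close>)
qed (rule tensor_op.agree, auto)

text \<open>Negation is left multiplication by -1, which \<sigma> fixes because it is
  central.\<close>

lemma tensor_op_minus:
  assumes "tensor_op f g" "tensor_op f' g'"
  shows "tensor_op (\<lambda>x. f x \<ominus> f' x) (\<lambda>x. g x \<ominus> g' x)"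
proof -
  have "tensor_op (\<lambda>x. \<ominus> \<one> \<otimes> f' x) (\<lambda>x. \<ominus> \<one> \<otimes> g' x)"
    using tensor_op_left[OF assms(2), of "\<ominus> \<one>"] \<sigma>_centre[OF minus_one_centre]
      centre_in_L[OF minus_one_centre] by simp
  from tensor_op.plus[OF assms(1) this] show ?thesis
    by (rule tensor_op.agree) (use tensor_op_closed[OF assms(2)] in \<open>auto simp: a_minus_def l_minus\<close>)
qed

lemma tensor_op_add:
  assumes "tensor_op f g" "x \<in> carrier R" "y \<in> carrier R"
  shows "f (x \<oplus> y) = f x \<oplus> f y"
  using assms(1)
proof (induction rule: tensor_op.induct)
  case (pure l b)
  then show ?case using assms by (simp add: LD l_distr r_distr)
next
  case (plus f g f' g')
  then show ?case using assms tensor_op_closed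
    by (simp add: a_ac)
qed (use assms in simp)

text \<open>Commutativity of \<open>L\<close> lets \<open>l\<close> pass the left factors. For the
  twist this could fail, as \<sigma> need not map into \<open>L\<close>.\<close>

lemma tensor_op_scale:
  assumes "tensor_op f g" "x \<in> carrier R" "l \<in> L"
  shows "f (l \<otimes> x) = l \<otimes> f x"
  using assms(1)
proof (induction rule: tensor_op.induct)
  case (pure l' b)
  have c: "l \<in> carrier R" "l' \<in> carrier R" using LD(4) pure assms by auto
  have "l' \<otimes> l \<otimes> (x \<otimes> b) = l \<otimes> l' \<otimes> (x \<otimes> b)" using LD(9)[of l' l] pure assms by simp
  then show ?case using pure assms c by (simp add: m_assoc)
next
  case (plus f g f' g')
  then show ?case using assms tensor_op_closed by (simp add: r_distr LD)
qed (use assms in \<open>simp add: LD\<close>)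

lemma tensor_op_combine:
  assumes "tensor_op f g" "set Ks \<subseteq> L" "set xs \<subseteq> carrier R"
  shows "f (combine Ks xs) = combine Ks (map f xs)"
  using assms(2,3)
proof (induction Ks xs rule: combine.induct)
  case (1 k Ks u Us)
  have "combine Ks Us \<in> carrier R"
    using "1.prems" LD(1) by (intro combine_in_carrier) auto
  then show ?case
    using 1 tensor_op_add[OF assms(1)] tensor_op_scale[OF assms(1)] by (simp add: LD)
next
  case ("2_1" Us)
  have "f (\<zero> \<otimes> \<zero>) = \<zero> \<otimes> f \<zero>" by (rule tensor_op_scale[OF assms(1)]) (simp_all add: LD)
  then show ?case using tensor_op_closed[OF assms(1), of \<zero>] by simp
next
  case ("2_2" Ks)
  have "f (\<zero> \<otimes> \<zero>) = \<zero> \<otimes> f \<zero>" by (rule tensor_op_scale[OF assms(1)]) (simp_all add: LD)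
  then show ?case using tensor_op_closed[OF assms(1), of \<zero>] by simp
qed

text \<open>Expand the right factors in \<open>bs\<close> and move the central coordinates across
  \<open>x\<close> to the left factors. Since \<sigma> fixes the centre, the same coefficient list
  describes the twist.\<close>

lemma tensor_op_normal_form:
  assumes "tensor_op f g" "set bs \<subseteq> carrier R" "Span (centre R) bs = carrier R"
  shows "\<exists>ls. set ls \<subseteq> L \<and> length ls = length bs \<and>
    (\<forall>x\<in>carrier R. f x = combine (map (\<lambda>l. l \<otimes> x) ls) bs \<and> g x = combine (map (\<lambda>l. \<sigma> l \<otimes> x) ls) bs)"
  using assms(1)
proof (induction rule: tensor_op.induct)
  case (pure l b)
  obtain ks where ks: "set ks \<subseteq> centre R" "length ks = length bs" "b = combine ks bs"
    using Span_mem_iff_length_version[OF centre_subfield assms(2), of b] assms(3) pure by auto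
  have kc: "k \<in> carrier R" "k \<in> L" "k \<in> centre R" if "k \<in> set ks" for k
    using that ks(1) centre_in_L LD(4) by auto
  have kcomm: "k \<otimes> x = x \<otimes> k" if "k \<in> set ks" "x \<in> carrier R" for k x
    using centre_commute[OF kc(3)[OF that(1)] that(2)] .
  have *: "m \<otimes> x \<otimes> b = combine (map (\<lambda>k. m \<otimes> k \<otimes> x) ks) bs"
    if "m \<in> carrier R" "x \<in> carrier R" for m x
  proof -
    have "m \<otimes> x \<otimes> b = combine (map ((\<otimes>) (m \<otimes> x)) ks) bs"
      unfolding ks(3) using that kc assms(2) by (intro combine_r_distr) auto
    also have "map ((\<otimes>) (m \<otimes> x)) ks = map (\<lambda>k. m \<otimes> k \<otimes> x) ks"
    proof (rule map_cong[OF refl])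
      fix k assume k: "k \<in> set ks"
      show "m \<otimes> x \<otimes> k = m \<otimes> k \<otimes> x" using that kc(1)[OF k] kcomm[OF k that(2)] by (simp add: m_assoc)
    qed
    finally show ?thesis .
  qed
  have **: "map (\<lambda>m. m \<otimes> x) (map ((\<otimes>) l) ks) = map (\<lambda>k. l \<otimes> k \<otimes> x) ks"
    "map (\<lambda>m. \<sigma> m \<otimes> x) (map ((\<otimes>) l) ks) = map (\<lambda>k. \<sigma> l \<otimes> k \<otimes> x) ks" for x
    using kc pure \<sigma>_mult \<sigma>_centre by auto
  have l: "l \<in> carrier R" "\<sigma> l \<in> carrier R" using pure LD(4) \<sigma>_closed by auto
  have "set (map ((\<otimes>) l) ks) \<subseteq> L" using kc pure LD(8) by auto
  then show ?case
    using ks(2) by (intro exI[of _ "map ((\<otimes>) l) ks"]) (simp add: ** *[OF l(1)] *[OF l(2)] del: map_map)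
next
  case (plus f g f' g')
  then obtain ls ls' where ls: "set ls \<subseteq> L" "length ls = length bs" "set ls' \<subseteq> L" "length ls' = length bs"
    and eq: "\<And>x. x \<in> carrier R \<Longrightarrow> f x = combine (map (\<lambda>l. l \<otimes> x) ls) bs"
      "\<And>x. x \<in> carrier R \<Longrightarrow> g x = combine (map (\<lambda>l. \<sigma> l \<otimes> x) ls) bs"
      "\<And>x. x \<in> carrier R \<Longrightarrow> f' x = combine (map (\<lambda>l. l \<otimes> x) ls') bs"
      "\<And>x. x \<in> carrier R \<Longrightarrow> g' x = combine (map (\<lambda>l. \<sigma> l \<otimes> x) ls') bs" by blast
  have *: "combine (map h ls) bs \<oplus> combine (map h ls') bs = combine (map h (map2 (\<oplus>) ls ls')) bs"
    if h: "\<And>l. l \<in> L \<Longrightarrow> h l \<in> carrier R"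
      "\<And>l l'. l \<in> L \<Longrightarrow> l' \<in> L \<Longrightarrow> h (l \<oplus> l') = h l \<oplus> h l'" for h
  proof -
    have "map h (map2 (\<oplus>) ls ls') = map2 (\<oplus>) (map h ls) (map h ls')"
      using ls h by (intro map_map2_add[where A = L]) auto
    then show ?thesis using ls h assms(2) by (subst combine_add) auto
  qed
  have "a \<oplus> a' \<in> L" if "(a, a') \<in> set (zip ls ls')" for a a'
    using set_zip_leftD[OF that] set_zip_rightD[OF that] ls LD(6) by blast
  then have "set (map2 (\<oplus>) ls ls') \<subseteq> L" by auto
  moreover have "f x \<oplus> f' x = combine (map (\<lambda>l. l \<otimes> x) (map2 (\<oplus>) ls ls')) bs"
    "g x \<oplus> g' x = combine (map (\<lambda>l. \<sigma> l \<otimes> x) (map2 (\<oplus>) ls ls')) bs" if "x \<in> carrier R" for x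
    using that *[of "\<lambda>l. l \<otimes> x"] *[of "\<lambda>l. \<sigma> l \<otimes> x"] eq[OF that]
    by (simp_all add: LD \<sigma>_closed \<sigma>_add l_distr)
  ultimately show ?case using ls by (intro exI[of _ "map2 (\<oplus>) ls ls'"]) auto
next
  case (agree f g f' g')
  then show ?case by simp
qed

text \<open>This is the well-definedness of the twist, which is why \<open>tensor_op\<close> could
  be introduced only as a relation: a vanishing operator has zero coefficients in normal form by
  \<open>combine_central_zero\<close>, so the twisted coefficients vanish too.\<close>

lemma tensor_op_zero:
  assumes "tensor_op f g" "independent (centre R) bs" "Span (centre R) bs = carrier R"
    and "\<And>x. x \<in> carrier R \<Longrightarrow> f x = \<zero>" "x \<in> carrier R"
  shows "g x = \<zero>"
proof -
  have bs: "set bs \<subseteq> carrier R" using independent_in_carrier[OF assms(2)] .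
  obtain ls where ls: "set ls \<subseteq> L" "length ls = length bs"
    and eq: "\<And>x. x \<in> carrier R \<Longrightarrow> f x = combine (map (\<lambda>l. l \<otimes> x) ls) bs"
      "\<And>x. x \<in> carrier R \<Longrightarrow> g x = combine (map (\<lambda>l. \<sigma> l \<otimes> x) ls) bs"
    using tensor_op_normal_form[OF assms(1) bs assms(3)] by blast
  have "set ls \<subseteq> {\<zero>}"
    using combine_central_zero[OF assms(2) ls(2)] ls(1) LD(1) eq(1) assms(4) by auto
  moreover have "\<sigma> \<zero> = \<zero>" using \<sigma>_centre subfieldD(2)[OF centre_subfield] by blast
  ultimately have "set (map (\<lambda>l. \<sigma> l \<otimes> x) ls) \<subseteq> {\<zero>}" using assms(5) by auto
  then show ?thesis using eq(2)[OF assms(5)] combine_all_zero bs by simp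
qed

text \<open>Jacobson density for the commuting actions of \<open>L\<close> (left) and \<open>R\<close> (right), proved by induction
  on the number of vectors: an operator killing \<open>xs\<close> and normalized to \<open>1\<close> at \<open>w\<close> takes at \<open>v\<close> a value
  in the centralizer of \<open>L\<close>, unless \<open>v\<close> can be separated from \<open>w\<close> and \<open>xs\<close>.\<close>

lemma density:
  assumes centralizer: "\<And>x. \<lbrakk>x \<in> carrier R; \<And>l. l \<in> L \<Longrightarrow> l \<otimes> x = x \<otimes> l\<rbrakk> \<Longrightarrow> x \<in> L"
    and "independent L (v # xs)"
  shows "\<exists>f g. tensor_op f g \<and> (\<forall>x\<in>set xs. f x = \<zero>) \<and> f v = \<one>"
  using assms(2)
proof (induction xs arbitrary: v rule: list.induct)
  case Nil
  then have v: "v \<in> carrier R" "v \<noteq> \<zero>" using independent_backwards[OF Nil] by auto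
  have "tensor_op (\<lambda>x. \<one> \<otimes> x \<otimes> inv v) (\<lambda>x. \<sigma> \<one> \<otimes> x \<otimes> inv v)"
    using v by (intro tensor_op.pure) (simp_all add: LD)
  then show ?case using v by force
next
  case (Cons w xs)
  note ind = independent_backwards[OF Cons.prems]
  note ind' = independent_backwards[OF ind(2)]
  have xs: "set xs \<subseteq> carrier R" using independent_in_carrier[OF ind'(2)] .
  obtain f0 g0 where f0: "tensor_op f0 g0" "\<And>x. x \<in> set xs \<Longrightarrow> f0 x = \<zero>" "f0 w = \<one>"
    using Cons.IH[OF ind(2)] by blast
  have v: "v \<in> carrier R" and w: "w \<in> carrier R" using ind ind' by auto
  show ?case
  proof (rule ccontr)
    assume no: "\<not> ?thesis"
    \<comment> \<open>A nonzero value at \<open>v\<close> could be normalized to 1 by right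
      multiplication, against \<open>no\<close>.\<close>
    have kills: "f v = \<zero>" if f: "tensor_op f g" "\<And>x. x \<in> set (w # xs) \<Longrightarrow> f x = \<zero>" for f g
    proof (rule ccontr)
      assume "f v \<noteq> \<zero>"
      moreover have fv: "f v \<in> carrier R" using tensor_op_closed[OF f(1) v] by simp
      ultimately have i: "inv (f v) \<in> carrier R" "f v \<otimes> inv (f v) = \<one>" by auto
      have "\<forall>x\<in>set (w # xs). f x \<otimes> inv (f v) = \<zero>" using f(2) i(1) by simp
      with no tensor_op_right[OF f(1) i(1)] i(2) show False by blast
    qed
    define c where "c = f0 v"
    have cc: "c \<in> carrier R" using tensor_op_closed[OF f0(1) v] by (simp add: c_def)
    have "l \<otimes> c = c \<otimes> l" if l: "l \<in> L" for l
    proof -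
      have lc: "l \<in> carrier R" using l LD by simp
      \<comment> \<open>The commutator of \<open>f0\<close> with \<open>l\<close> vanishes at
        \<open>w\<close> because \<open>f0 w = \<one>\<close>, hence also at
        \<open>v\<close>.\<close>
      have "l \<otimes> f0 v \<ominus> f0 v \<otimes> l = \<zero>"
      proof (rule kills[of "\<lambda>x. l \<otimes> f0 x \<ominus> f0 x \<otimes> l"])
        show "tensor_op (\<lambda>x. l \<otimes> f0 x \<ominus> f0 x \<otimes> l) (\<lambda>x. \<sigma> l \<otimes> g0 x \<ominus> g0 x \<otimes> l)"
          by (intro tensor_op_minus tensor_op_left tensor_op_right f0(1) l lc)
      qed (use f0 lc in \<open>auto simp: a_minus_def r_neg\<close>)
      then show ?thesis using cc lc by (simp add: c_def r_right_minus_eq)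
    qed
    then have cL: "c \<in> L" using centralizer cc by blast
    define u where "u = v \<ominus> c \<otimes> w"
    have u: "u \<in> carrier R" using v w cc by (simp add: u_def)
    have "u \<notin> Span L xs"
    proof
      assume "u \<in> Span L xs"
      then have "c \<otimes> w \<oplus> u \<in> Span L (w # xs)" using cL by (auto simp: line_extension_mem_iff)
      moreover have "c \<otimes> w \<oplus> u = v" using v w cc by (simp add: u_def a_minus_def a_ac r_neg r_neg2)
      ultimately show False using ind(1) by simp
    qed
    then have "independent L (u # xs)" using u ind'(2) by (intro li_Cons)
    from Cons.IH[OF this] obtain f g where f: "tensor_op f g" "\<And>x. x \<in> set xs \<Longrightarrow> f x = \<zero>" "f u = \<one>"
      by blast
    have fw: "f w \<in> carrier R" "f v \<in> carrier R" using tensor_op_closed[OF f(1)] v w by auto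
    \<comment> \<open>Subtracting \<open>f0\<close> times the value \<open>f w\<close> makes the
      operator vanish at \<open>w\<close> as well. The outcome \<open>f v = c \<otimes> f w\<close>
      says \<open>f u = \<zero>\<close>, against \<open>f u = \<one>\<close>.\<close>
    have "f v \<ominus> f0 v \<otimes> f w = \<zero>"
    proof (rule kills[of "\<lambda>x. f x \<ominus> f0 x \<otimes> f w"])
      show "tensor_op (\<lambda>x. f x \<ominus> f0 x \<otimes> f w) (\<lambda>x. g x \<ominus> g0 x \<otimes> f w)"
        by (intro tensor_op_minus tensor_op_right f0(1) f(1) fw)
    qed (use f f0 fw in \<open>auto simp: a_minus_def r_neg\<close>)
    then have "f v = c \<otimes> f w" using fw cc by (simp add: c_def r_right_minus_eq)
    moreover have "f u \<oplus> c \<otimes> f w = f v"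
    proof -
      have "u \<oplus> c \<otimes> w = v" using v w cc by (simp add: u_def a_minus_def a_assoc l_neg)
      then show ?thesis
        using tensor_op_add[OF f(1) u, of "c \<otimes> w"] tensor_op_scale[OF f(1) w cL] cc w by simp
    qed
    ultimately show False using f(3) fw cc
      by (metis a_comm add.r_cancel_one' m_closed one_closed one_neq_zero)
  qed
qed

text \<open>Newton-style correction: once the values on \<open>us\<close> are right, add the
  operator of \<open>density\<close> that vanishes on \<open>us\<close> and is 1 at
  \<open>u\<close>, multiplied on the right by the error at \<open>u\<close>.\<close>

lemma interpolation:
  assumes centralizer: "\<And>x. \<lbrakk>x \<in> carrier R; \<And>l. l \<in> L \<Longrightarrow> l \<otimes> x = x \<otimes> l\<rbrakk> \<Longrightarrow> x \<in> L"
    and "independent L us" "length ys = length us" "set ys \<subseteq> carrier R"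
  shows "\<exists>f g. tensor_op f g \<and> map f us = ys"
  using assms(2-)
proof (induction us arbitrary: ys rule: list.induct)
  case Nil
  have "tensor_op (\<lambda>x. \<one> \<otimes> x \<otimes> \<one>) (\<lambda>x. \<sigma> \<one> \<otimes> x \<otimes> \<one>)" by (intro tensor_op.pure) (simp_all add: LD)
  then show ?case using Nil by auto
next
  case (Cons u us)
  then obtain y ys' where ys: "ys = y # ys'" by (cases ys) auto
  note ind = independent_backwards[OF Cons.prems(1)]
  obtain f g where f: "tensor_op f g" "map f us = ys'"
    using Cons.IH[OF ind(2), of ys'] Cons.prems ys by auto
  obtain f' g' where f': "tensor_op f' g'" "\<And>x. x \<in> set us \<Longrightarrow> f' x = \<zero>" "f' u = \<one>"
    using density[OF centralizer Cons.prems(1)] by blast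
  define d where "d = y \<ominus> f u"
  have y: "y \<in> carrier R" and fu: "f u \<in> carrier R"
    using Cons.prems ys tensor_op_closed[OF f(1) ind(3)] by auto
  then have d: "d \<in> carrier R" by (simp add: d_def)
  have us: "set us \<subseteq> carrier R" using independent_in_carrier[OF ind(2)] .
  have "tensor_op (\<lambda>x. f x \<oplus> f' x \<otimes> d) (\<lambda>x. g x \<oplus> g' x \<otimes> d)"
    by (intro tensor_op.plus tensor_op_right f(1) f'(1) d)
  moreover have "f u \<oplus> f' u \<otimes> d = y"
    using f'(3) y fu d by (simp add: d_def a_minus_def a_ac r_neg r_neg2)
  moreover have "f x \<oplus> f' x \<otimes> d = f x" if "x \<in> set us" for x
    using that f'(2) d us tensor_op_closed(1)[OF f(1), of x] by auto
  then have "map (\<lambda>x. f x \<oplus> f' x \<otimes> d) us = ys'" using f(2) by auto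
  ultimately show ?case using ys
    by (intro exI[of _ "\<lambda>x. f x \<oplus> f' x \<otimes> d"] exI[of _ "\<lambda>x. g x \<oplus> g' x \<otimes> d"]) simp
qed

section \<open>Intertwining elements and inner automorphisms\<close>

text \<open>Suppose an operator kills \<open>xs\<close> with nonzero twist, but none does so for
  \<open>x # xs\<close>. Normalize it to 1 at \<open>x\<close>; its commutator with each
  \<open>l\<close> then kills \<open>x # xs\<close>, so the twist of the commutator vanishes, and a
  nonzero value of the twist is an intertwiner.\<close>

lemma intertwiner_or_annihilator:
  assumes "set xs \<subseteq> carrier R"
  shows "(\<exists>y\<in>carrier R. y \<noteq> \<zero> \<and> (\<forall>l\<in>L. \<sigma> l \<otimes> y = y \<otimes> l)) \<or>
    (\<exists>f g. tensor_op f g \<and> (\<forall>x\<in>set xs. f x = \<zero>) \<and> (\<exists>u\<in>carrier R. g u \<noteq> \<zero>))"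
  using assms
proof (induction xs)
  case Nil
  have "tensor_op (\<lambda>x. \<one> \<otimes> x \<otimes> \<one>) (\<lambda>x. \<sigma> \<one> \<otimes> x \<otimes> \<one>)" by (intro tensor_op.pure) (simp_all add: LD)
  moreover have "\<sigma> \<one> \<otimes> \<one> \<otimes> \<one> \<noteq> \<zero>" using \<sigma>_centre[OF one_centre] by simp
  ultimately show ?case by (intro disjI2) force
next
  case (Cons x xs)
  have x: "x \<in> carrier R" using Cons.prems by simp
  show ?case
  proof (rule disjCI)
    assume no: "\<not> (\<exists>f g. tensor_op f g \<and> (\<forall>z\<in>set (x # xs). f z = \<zero>) \<and> (\<exists>u\<in>carrier R. g u \<noteq> \<zero>))"
    have kills: "g u = \<zero>"
      if "tensor_op f g" "\<And>z. z \<in> set (x # xs) \<Longrightarrow> f z = \<zero>" "u \<in> carrier R" for f g u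
      using no that by blast
    show "\<exists>y\<in>carrier R. y \<noteq> \<zero> \<and> (\<forall>l\<in>L. \<sigma> l \<otimes> y = y \<otimes> l)"
    proof (rule ccontr)
      assume no': "\<not> ?thesis"
      then obtain f g u where f: "tensor_op f g" "\<And>z. z \<in> set xs \<Longrightarrow> f z = \<zero>"
        and u: "u \<in> carrier R" "g u \<noteq> \<zero>" using Cons by auto
      have "f x \<noteq> \<zero>" using kills[OF f(1) _ u(1)] f(2) u(2) by auto
      moreover have fx: "f x \<in> carrier R" using tensor_op_closed[OF f(1) x] by simp
      ultimately have i: "inv (f x) \<in> carrier R" "f x \<otimes> inv (f x) = \<one>" by auto
      define f0 where "f0 = (\<lambda>z. f z \<otimes> inv (f x))"
      define g0 where "g0 = (\<lambda>z. g z \<otimes> inv (f x))"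
      have f0: "tensor_op f0 g0" "\<And>z. z \<in> set xs \<Longrightarrow> f0 z = \<zero>" "f0 x = \<one>"
        using tensor_op_right[OF f(1) i(1)] f(2) i by (simp_all add: f0_def g0_def)
      have y: "g0 u \<in> carrier R" using tensor_op_closed[OF f0(1) u(1)] by simp
      have "g u \<in> carrier R" using tensor_op_closed[OF f(1) u(1)] by simp
      then have "g0 u \<noteq> \<zero>" using u(2) i(1) \<open>f x \<noteq> \<zero>\<close> fx by (simp add: g0_def)
      moreover have "\<sigma> l \<otimes> g0 u = g0 u \<otimes> l" if l: "l \<in> L" for l
      proof -
        have lc: "l \<in> carrier R" using l LD by simp
        have "\<sigma> l \<otimes> g0 u \<ominus> g0 u \<otimes> l = \<zero>"
        proof (rule kills[of "\<lambda>x. l \<otimes> f0 x \<ominus> f0 x \<otimes> l" "\<lambda>x. \<sigma> l \<otimes> g0 x \<ominus> g0 x \<otimes> l"])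
          show "tensor_op (\<lambda>x. l \<otimes> f0 x \<ominus> f0 x \<otimes> l) (\<lambda>x. \<sigma> l \<otimes> g0 x \<ominus> g0 x \<otimes> l)"
            by (intro tensor_op_minus tensor_op_left tensor_op_right f0(1) l lc)
        qed (use f0 lc u in \<open>auto simp: a_minus_def r_neg\<close>)
        then show ?thesis using y lc l by (simp add: r_right_minus_eq \<sigma>_closed)
      qed
      ultimately show False using no' y by blast
    qed
  qed
qed

text \<open>Take a central basis as the list of vectors: an operator killing it is zero by
  linearity, so its twist is zero by \<open>tensor_op_zero\<close>, and only the intertwiner
  remains.\<close>

theorem skolem_noether:
  assumes "independent (centre R) bs" "Span (centre R) bs = carrier R"
  shows "\<exists>y\<in>carrier R. y \<noteq> \<zero> \<and> (\<forall>l\<in>L. \<sigma> l \<otimes> y = y \<otimes> l)"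
proof -
  have bs: "set bs \<subseteq> carrier R" using independent_in_carrier[OF assms(1)] .
  have False if f: "tensor_op f g" "\<forall>x\<in>set bs. f x = \<zero>" and u: "u \<in> carrier R" "g u \<noteq> \<zero>" for f g u
  proof -
    have "f x = \<zero>" if x: "x \<in> carrier R" for x
    proof -
      obtain ks where ks: "set ks \<subseteq> centre R" "x = combine ks bs"
        using Span_eq_combine_set[OF centre_subfield bs] assms(2) x by blast
      have "f x = combine ks (map f bs)"
        unfolding ks(2) using ks(1) centre_subset bs by (intro tensor_op_combine[OF f(1)]) auto
      also have "map f bs = map (\<lambda>_. \<zero>) bs" using f(2) by auto
      also have "combine ks (map (\<lambda>_. \<zero>) bs) = \<zero>"
        using subset_trans[OF ks(1) subfieldD(1)[OF centre_subfield]] by (rule combine_zero_vectors)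
      finally show ?thesis .
    qed
    from tensor_op_zero[OF f(1) assms this u(1)] u(2) show False by simp
  qed
  then show ?thesis using intertwiner_or_annihilator[OF bs] by blast
qed

end

section \<open>Matrix rings\<close>

lemma (in abelian_monoid) finsum_swap:
  assumes "finite A" "finite C" "\<And>i j. i \<in> A \<Longrightarrow> j \<in> C \<Longrightarrow> f i j \<in> carrier G"
  shows "(\<Oplus>i\<in>A. \<Oplus>j\<in>C. f i j) = (\<Oplus>j\<in>C. \<Oplus>i\<in>A. f i j)"
  using assms(1,3)
proof (induction A rule: finite_induct)
  case empty
  then show ?case by (simp add: finsum_zero)
next
  case (insert a A)
  have "(\<Oplus>j\<in>C. \<Oplus>i\<in>insert a A. f i j) = (\<Oplus>j\<in>C. f a j \<oplus> (\<Oplus>i\<in>A. f i j))"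
    using insert by (intro finsum_cong') (auto intro!: finsum_closed finsum_insert)
  also have "\<dots> = (\<Oplus>j\<in>C. f a j) \<oplus> (\<Oplus>j\<in>C. \<Oplus>i\<in>A. f i j)"
    using insert by (intro finsum_addf) (auto intro!: finsum_closed)
  also have "\<dots> = (\<Oplus>i\<in>insert a A. \<Oplus>j\<in>C. f i j)"
    using insert by (subst finsum_insert) (auto intro!: finsum_closed)
  finally show ?case by simp
qed

context field
begin

lemma matrix_ring_simps:
  "carrier (matrix_ring R n) = {..<n} \<times> {..<n} \<rightarrow>\<^sub>E carrier R"
  "\<lbrakk>i < n; j < n\<rbrakk> \<Longrightarrow> (A \<otimes>\<^bsub>matrix_ring R n\<^esub> A') (i, j) = (\<Oplus>l\<in>{..<n}. A (i, l) \<otimes> A' (l, j))"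
  "\<lbrakk>i < n; j < n\<rbrakk> \<Longrightarrow> (A \<oplus>\<^bsub>matrix_ring R n\<^esub> A') (i, j) = A (i, j) \<oplus> A' (i, j)"
  "\<lbrakk>i < n; j < n\<rbrakk> \<Longrightarrow> \<one>\<^bsub>matrix_ring R n\<^esub> (i, j) = (if i = j then \<one> else \<zero>)"
  "\<lbrakk>i < n; j < n\<rbrakk> \<Longrightarrow> \<zero>\<^bsub>matrix_ring R n\<^esub> (i, j) = \<zero>"
  "\<lbrakk>i < n; j < n\<rbrakk> \<Longrightarrow> scalar_matrix R n c (i, j) = (if i = j then c else \<zero>)"
  by (simp_all add: matrix_ring_def scalar_matrix_def)

lemma matrix_entry_closed [simp]:
  "\<lbrakk>A \<in> carrier (matrix_ring R n); i < n; j < n\<rbrakk> \<Longrightarrow> A (i, j) \<in> carrier R"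
  by (auto simp: matrix_ring_simps)

lemma matrix_eqI:
  assumes "A \<in> carrier (matrix_ring R n)" "A' \<in> carrier (matrix_ring R n)"
    "\<And>i j. \<lbrakk>i < n; j < n\<rbrakk> \<Longrightarrow> A (i, j) = A' (i, j)"
  shows "A = A'"
  by (rule PiE_ext[OF assms(1,2)[unfolded matrix_ring_simps]]) (use assms(3) in auto)

lemma matrix_ops_closed [simp]:
  "\<lbrakk>A \<in> carrier (matrix_ring R n); A' \<in> carrier (matrix_ring R n)\<rbrakk> \<Longrightarrow>
    A \<otimes>\<^bsub>matrix_ring R n\<^esub> A' \<in> carrier (matrix_ring R n)"
  "\<lbrakk>A \<in> carrier (matrix_ring R n); A' \<in> carrier (matrix_ring R n)\<rbrakk> \<Longrightarrow>
    A \<oplus>\<^bsub>matrix_ring R n\<^esub> A' \<in> carrier (matrix_ring R n)"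
  "\<one>\<^bsub>matrix_ring R n\<^esub> \<in> carrier (matrix_ring R n)"
  "\<zero>\<^bsub>matrix_ring R n\<^esub> \<in> carrier (matrix_ring R n)"
  "c \<in> carrier R \<Longrightarrow> scalar_matrix R n c \<in> carrier (matrix_ring R n)"
  by (auto simp: matrix_ring_def scalar_matrix_def intro!: finsum_closed)

lemma finsum_delta_mult:
  assumes "i < n" "\<And>l. l < n \<Longrightarrow> f l \<in> carrier R" "c \<in> carrier R"
  shows "(\<Oplus>l\<in>{..<n::nat}. (if i = l then c else \<zero>) \<otimes> f l) = c \<otimes> f i"
proof -
  have "(\<Oplus>l\<in>{..<n}. (if i = l then c else \<zero>) \<otimes> f l) = (\<Oplus>l\<in>{..<n}. if i = l then c \<otimes> f l else \<zero>)"
    using assms by (intro finsum_cong') auto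
  also have "\<dots> = c \<otimes> f i" using assms by (intro finsum_singleton) auto
  finally show ?thesis .
qed

lemma scalar_mult_entry:
  assumes "A \<in> carrier (matrix_ring R n)" "c \<in> carrier R" "i < n" "j < n"
  shows "(scalar_matrix R n c \<otimes>\<^bsub>matrix_ring R n\<^esub> A) (i, j) = c \<otimes> A (i, j)"
proof -
  have "(scalar_matrix R n c \<otimes>\<^bsub>matrix_ring R n\<^esub> A) (i, j)
      = (\<Oplus>l\<in>{..<n}. (if i = l then c else \<zero>) \<otimes> A (l, j))"
    unfolding matrix_ring_simps(2)[OF assms(3,4)] using assms
    by (intro finsum_cong') (auto simp: matrix_ring_simps(6))
  also have "\<dots> = c \<otimes> A (i, j)" using assms by (intro finsum_delta_mult) auto
  finally show ?thesis .
qed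

lemma mult_one_entry:
  assumes "A \<in> carrier (matrix_ring R n)" "i < n" "j < n"
  shows "(A \<otimes>\<^bsub>matrix_ring R n\<^esub> \<one>\<^bsub>matrix_ring R n\<^esub>) (i, j) = A (i, j)"
proof -
  have "(A \<otimes>\<^bsub>matrix_ring R n\<^esub> \<one>\<^bsub>matrix_ring R n\<^esub>) (i, j)
      = (\<Oplus>l\<in>{..<n}. if j = l then A (i, l) else \<zero>)"
    unfolding matrix_ring_simps(2)[OF assms(2,3)] using assms
    by (intro finsum_cong') (auto simp: matrix_ring_simps(4))
  also have "\<dots> = A (i, j)" using assms by (intro finsum_singleton) auto
  finally show ?thesis .
qed

lemma scalar_one: "scalar_matrix R n \<one> = \<one>\<^bsub>matrix_ring R n\<^esub>"
  by (simp add: scalar_matrix_def matrix_ring_def)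

lemma matrix_mult_assoc:
  assumes A: "A \<in> carrier (matrix_ring R n)" and A': "A' \<in> carrier (matrix_ring R n)"
    and A'': "A'' \<in> carrier (matrix_ring R n)"
  shows "A \<otimes>\<^bsub>matrix_ring R n\<^esub> A' \<otimes>\<^bsub>matrix_ring R n\<^esub> A''
    = A \<otimes>\<^bsub>matrix_ring R n\<^esub> (A' \<otimes>\<^bsub>matrix_ring R n\<^esub> A'')"
proof (rule matrix_eqI[where n = n])
  fix i j assume ij: "i < n" "j < n"
  have "(A \<otimes>\<^bsub>matrix_ring R n\<^esub> A' \<otimes>\<^bsub>matrix_ring R n\<^esub> A'') (i, j)
      = (\<Oplus>l\<in>{..<n}. (\<Oplus>m\<in>{..<n}. A (i, m) \<otimes> A' (m, l)) \<otimes> A'' (l, j))"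
    unfolding matrix_ring_simps(2)[OF ij] using assms ij
    by (intro finsum_cong') (auto simp: matrix_ring_simps(2) intro!: finsum_closed)
  also have "\<dots> = (\<Oplus>l\<in>{..<n}. \<Oplus>m\<in>{..<n}. A (i, m) \<otimes> A' (m, l) \<otimes> A'' (l, j))"
    using assms ij by (intro finsum_cong') (auto intro!: finsum_ldistr finsum_closed)
  also have "\<dots> = (\<Oplus>m\<in>{..<n}. \<Oplus>l\<in>{..<n}. A (i, m) \<otimes> A' (m, l) \<otimes> A'' (l, j))"
    using assms ij by (intro finsum_swap) auto
  also have "\<dots> = (\<Oplus>m\<in>{..<n}. \<Oplus>l\<in>{..<n}. A (i, m) \<otimes> (A' (m, l) \<otimes> A'' (l, j)))"
    using assms ij by (simp add: m_assoc cong: finsum_cong)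
  also have "\<dots> = (\<Oplus>m\<in>{..<n}. A (i, m) \<otimes> (\<Oplus>l\<in>{..<n}. A' (m, l) \<otimes> A'' (l, j)))"
    using assms ij by (intro finsum_cong') (auto intro!: finsum_rdistr[symmetric] finsum_closed)
  also have "\<dots> = (A \<otimes>\<^bsub>matrix_ring R n\<^esub> (A' \<otimes>\<^bsub>matrix_ring R n\<^esub> A'')) (i, j)"
    unfolding matrix_ring_simps(2)[OF ij] using assms ij
    by (intro finsum_cong') (auto simp: matrix_ring_simps(2) intro!: finsum_closed)
  finally show "(A \<otimes>\<^bsub>matrix_ring R n\<^esub> A' \<otimes>\<^bsub>matrix_ring R n\<^esub> A'') (i, j)
    = (A \<otimes>\<^bsub>matrix_ring R n\<^esub> (A' \<otimes>\<^bsub>matrix_ring R n\<^esub> A'')) (i, j)" .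
qed (use assms in simp_all)

lemma matrix_ring_is_ring: "ring (matrix_ring R n)"
proof (rule ringI)
  show "abelian_group (matrix_ring R n)"
  proof (rule abelian_groupI)
    fix A assume A: "A \<in> carrier (matrix_ring R n)"
    let ?A = "\<lambda>(i, j) \<in> {..<n} \<times> {..<n}. \<ominus> A (i, j)"
    have "?A \<in> carrier (matrix_ring R n)" using A by (auto simp: matrix_ring_simps(1) intro!: a_inv_closed)
    moreover from this have "?A \<oplus>\<^bsub>matrix_ring R n\<^esub> A = \<zero>\<^bsub>matrix_ring R n\<^esub>"
      using A by (intro matrix_eqI[where n = n]) (simp_all add: matrix_ring_simps(3,5) l_neg)
    ultimately show "\<exists>A'\<in>carrier (matrix_ring R n). A' \<oplus>\<^bsub>matrix_ring R n\<^esub> A = \<zero>\<^bsub>matrix_ring R n\<^esub>"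
      by blast
  qed (auto intro!: matrix_eqI[where n = n] simp: matrix_ring_simps(3,5) a_ac)
  show "monoid (matrix_ring R n)"
  proof (rule monoidI)
    fix A assume A: "A \<in> carrier (matrix_ring R n)"
    show "\<one>\<^bsub>matrix_ring R n\<^esub> \<otimes>\<^bsub>matrix_ring R n\<^esub> A = A"
      using A scalar_mult_entry[of A n \<one>] by (intro matrix_eqI[where n = n]) (simp_all add: scalar_one)
    show "A \<otimes>\<^bsub>matrix_ring R n\<^esub> \<one>\<^bsub>matrix_ring R n\<^esub> = A"
      using A mult_one_entry[of A n] by (intro matrix_eqI[where n = n]) simp_all
  qed (simp_all add: matrix_mult_assoc)
next
  fix A A' A''
  assume A: "A \<in> carrier (matrix_ring R n)" "A' \<in> carrier (matrix_ring R n)" "A'' \<in> carrier (matrix_ring R n)"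
  show "(A \<oplus>\<^bsub>matrix_ring R n\<^esub> A') \<otimes>\<^bsub>matrix_ring R n\<^esub> A''
    = A \<otimes>\<^bsub>matrix_ring R n\<^esub> A'' \<oplus>\<^bsub>matrix_ring R n\<^esub> A' \<otimes>\<^bsub>matrix_ring R n\<^esub> A''"
  proof (rule matrix_eqI[where n = n])
    fix i j assume ij: "i < n" "j < n"
    have "((A \<oplus>\<^bsub>matrix_ring R n\<^esub> A') \<otimes>\<^bsub>matrix_ring R n\<^esub> A'') (i, j)
        = (\<Oplus>l\<in>{..<n}. A (i, l) \<otimes> A'' (l, j) \<oplus> A' (i, l) \<otimes> A'' (l, j))"
      unfolding matrix_ring_simps(2)[OF ij] using A ij
      by (intro finsum_cong') (auto simp: matrix_ring_simps(3) l_distr)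
    also have "\<dots> = (A \<otimes>\<^bsub>matrix_ring R n\<^esub> A'' \<oplus>\<^bsub>matrix_ring R n\<^esub> A' \<otimes>\<^bsub>matrix_ring R n\<^esub> A'') (i, j)"
      unfolding matrix_ring_simps(2,3)[OF ij] using A ij by (intro finsum_addf) auto
    finally show "((A \<oplus>\<^bsub>matrix_ring R n\<^esub> A') \<otimes>\<^bsub>matrix_ring R n\<^esub> A'') (i, j) = \<dots>" .
  qed (use A in simp_all)
  show "A'' \<otimes>\<^bsub>matrix_ring R n\<^esub> (A \<oplus>\<^bsub>matrix_ring R n\<^esub> A')
    = A'' \<otimes>\<^bsub>matrix_ring R n\<^esub> A \<oplus>\<^bsub>matrix_ring R n\<^esub> A'' \<otimes>\<^bsub>matrix_ring R n\<^esub> A'"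
  proof (rule matrix_eqI[where n = n])
    fix i j assume ij: "i < n" "j < n"
    have "(A'' \<otimes>\<^bsub>matrix_ring R n\<^esub> (A \<oplus>\<^bsub>matrix_ring R n\<^esub> A')) (i, j)
        = (\<Oplus>l\<in>{..<n}. A'' (i, l) \<otimes> A (l, j) \<oplus> A'' (i, l) \<otimes> A' (l, j))"
      unfolding matrix_ring_simps(2)[OF ij] using A ij
      by (intro finsum_cong') (auto simp: matrix_ring_simps(3) r_distr)
    also have "\<dots> = (A'' \<otimes>\<^bsub>matrix_ring R n\<^esub> A \<oplus>\<^bsub>matrix_ring R n\<^esub> A'' \<otimes>\<^bsub>matrix_ring R n\<^esub> A') (i, j)"
      unfolding matrix_ring_simps(2,3)[OF ij] using A ij by (intro finsum_addf) auto
    finally show "(A'' \<otimes>\<^bsub>matrix_ring R n\<^esub> (A \<oplus>\<^bsub>matrix_ring R n\<^esub> A')) (i, j) = \<dots>" .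
  qed (use A in simp_all)
qed

lemma scalar_matrix_hom: "scalar_matrix R n \<in> ring_hom R (matrix_ring R n)"
proof (rule ring_hom_memI)
  fix c c' assume c: "c \<in> carrier R" "c' \<in> carrier R"
  show "scalar_matrix R n (c \<otimes> c') = scalar_matrix R n c \<otimes>\<^bsub>matrix_ring R n\<^esub> scalar_matrix R n c'"
    using c by (intro matrix_eqI[where n = n]) (simp_all add: scalar_mult_entry matrix_ring_simps(6))
  show "scalar_matrix R n (c \<oplus> c') = scalar_matrix R n c \<oplus>\<^bsub>matrix_ring R n\<^esub> scalar_matrix R n c'"
    using c by (intro matrix_eqI[where n = n]) (simp_all add: matrix_ring_simps(3,6))
qed (simp_all add: scalar_one)

lemma scalar_matrices_subfield:
  assumes "n > 0"
  shows "subfield (scalar_matrix R n ` carrier R) (matrix_ring R n)"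
proof -
  interpret h: ring_hom_ring R "matrix_ring R n" "scalar_matrix R n"
    by (rule ring_hom_ringI2) (simp_all add: ring_axioms matrix_ring_is_ring scalar_matrix_hom)
  have "\<one>\<^bsub>matrix_ring R n\<^esub> (0, 0) \<noteq> \<zero>\<^bsub>matrix_ring R n\<^esub> (0, 0)"
    using assms by (simp add: matrix_ring_simps(4,5))
  then have "\<one>\<^bsub>matrix_ring R n\<^esub> \<noteq> \<zero>\<^bsub>matrix_ring R n\<^esub>" by metis
  then show ?thesis using h.img_is_subfield(2)[OF carrier_is_subfield] by blast
qed

text \<open>Enlarging the allowed support by one index pair adds one line, spanned by a matrix unit;
  an arbitrary matrix splits off its entry there as a scalar multiple of that unit.\<close>

lemma matrix_dimension_support:
  assumes "n > 0" "finite P" "P \<subseteq> {..<n} \<times> {..<n}"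
  shows "ring.dimension (matrix_ring R n) (card P) (scalar_matrix R n ` carrier R)
    {A \<in> carrier (matrix_ring R n). \<forall>p\<in>{..<n} \<times> {..<n} - P. A p = \<zero>}"
proof -
  interpret M: ring "matrix_ring R n" by (rule matrix_ring_is_ring)
  let ?K = "scalar_matrix R n ` carrier R"
  let ?E = "\<lambda>P. {A \<in> carrier (matrix_ring R n). \<forall>p\<in>{..<n} \<times> {..<n} - P. A p = \<zero>}"
  show ?thesis using assms(2,3)
  proof (induction P rule: finite_induct)
    case empty
    have "?E {} = {\<zero>\<^bsub>matrix_ring R n\<^esub>}"
      by (auto intro!: matrix_eqI[where n = n] simp: matrix_ring_simps(5))
    then show ?case by simp
  next
    case (insert p P)
    \<comment> \<open>\<open>V\<close> is the matrix unit at position \<open>p\<close>.\<close>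
    define V where "V = (\<lambda>q \<in> {..<n} \<times> {..<n}. if q = p then \<one> else \<zero>)"
    have V: "V \<in> carrier (matrix_ring R n)" by (auto simp: V_def matrix_ring_simps(1))
    have "V p = \<one>" using insert by (simp add: V_def)
    moreover have "p \<in> {..<n} \<times> {..<n} - P" using insert by auto
    ultimately have "V \<notin> ?E P" using one_not_zero by force
    moreover have "ring.line_extension (matrix_ring R n) ?K V (?E P) = ?E (insert p P)"
    proof
      show "M.line_extension ?K V (?E P) \<subseteq> ?E (insert p P)"
        using V by (auto simp: M.line_extension_mem_iff matrix_ring_simps(3) scalar_mult_entry)
          (simp add: V_def split: if_splits)
      show "?E (insert p P) \<subseteq> M.line_extension ?K V (?E P)"
      proof
        fix A assume A: "A \<in> ?E (insert p P)"
        then have Ac: "A \<in> carrier (matrix_ring R n)" by simp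
        have Ap: "A p \<in> carrier R"
          using PiE_mem[OF Ac[unfolded matrix_ring_simps(1)], of p] insert.prems by blast
        define W where "W = (\<lambda>q \<in> {..<n} \<times> {..<n}. if q = p then \<zero> else A q)"
        have W: "W \<in> carrier (matrix_ring R n)"
          using PiE_mem[OF Ac[unfolded matrix_ring_simps(1)]] by (auto simp: W_def matrix_ring_simps(1))
        have "A = scalar_matrix R n (A p) \<otimes>\<^bsub>matrix_ring R n\<^esub> V \<oplus>\<^bsub>matrix_ring R n\<^esub> W"
        proof (rule matrix_eqI[OF Ac])
          fix i j assume ij: "i < n" "j < n"
          show "A (i, j) = (scalar_matrix R n (A p) \<otimes>\<^bsub>matrix_ring R n\<^esub> V \<oplus>\<^bsub>matrix_ring R n\<^esub> W) (i, j)"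
            using ij V Ap Ac
            by (simp add: matrix_ring_simps(3) scalar_mult_entry) (auto simp: V_def W_def)
        qed (use V W Ap in simp)
        moreover have "W \<in> ?E P" using W A by (auto simp: W_def)
        ultimately show "A \<in> M.line_extension ?K V (?E P)"
          using Ap unfolding M.line_extension_mem_iff by blast
      qed
    qed
    ultimately show ?case
      using M.Suc_dim[OF V _ insert.IH] insert by simp
  qed
qed

lemma matrix_ring_dimension:
  assumes "n > 0"
  shows "ring.dimension (matrix_ring R n) (n\<^sup>2) (scalar_matrix R n ` carrier R) (carrier (matrix_ring R n))"
  using matrix_dimension_support[OF assms, of "{..<n} \<times> {..<n}"]
  by (simp add: power2_eq_square)

lemma matrix_trace_closed [simp]:
  "A \<in> carrier (matrix_ring R n) \<Longrightarrow> matrix_trace R n A \<in> carrier R"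
  by (auto simp: matrix_trace_def intro!: finsum_closed)

lemma matrix_trace_add:
  assumes "A \<in> carrier (matrix_ring R n)" "A' \<in> carrier (matrix_ring R n)"
  shows "matrix_trace R n (A \<oplus>\<^bsub>matrix_ring R n\<^esub> A') = matrix_trace R n A \<oplus> matrix_trace R n A'"
proof -
  have "matrix_trace R n (A \<oplus>\<^bsub>matrix_ring R n\<^esub> A') = (\<Oplus>i\<in>{..<n}. A (i, i) \<oplus> A' (i, i))"
    unfolding matrix_trace_def using assms by (intro finsum_cong') (auto simp: matrix_ring_simps(3))
  also have "\<dots> = matrix_trace R n A \<oplus> matrix_trace R n A'"
    unfolding matrix_trace_def using assms by (intro finsum_addf) auto
  finally show ?thesis .
qed

lemma matrix_trace_mult_comm:
  assumes "A \<in> carrier (matrix_ring R n)" "A' \<in> carrier (matrix_ring R n)"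
  shows "matrix_trace R n (A \<otimes>\<^bsub>matrix_ring R n\<^esub> A') = matrix_trace R n (A' \<otimes>\<^bsub>matrix_ring R n\<^esub> A)"
proof -
  have "matrix_trace R n (A \<otimes>\<^bsub>matrix_ring R n\<^esub> A') = (\<Oplus>i\<in>{..<n}. \<Oplus>l\<in>{..<n}. A (i, l) \<otimes> A' (l, i))"
    unfolding matrix_trace_def using assms
    by (intro finsum_cong') (auto simp: matrix_ring_simps(2) intro!: finsum_closed)
  also have "\<dots> = (\<Oplus>l\<in>{..<n}. \<Oplus>i\<in>{..<n}. A (i, l) \<otimes> A' (l, i))"
    using assms by (intro finsum_swap) auto
  also have "\<dots> = (\<Oplus>l\<in>{..<n}. \<Oplus>i\<in>{..<n}. A' (l, i) \<otimes> A (i, l))"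
    using assms by (intro finsum_cong' refl m_comm) (auto intro!: finsum_closed)
  also have "\<dots> = matrix_trace R n (A' \<otimes>\<^bsub>matrix_ring R n\<^esub> A)"
    unfolding matrix_trace_def using assms
    by (intro finsum_cong') (auto simp: matrix_ring_simps(2) intro!: finsum_closed)
  finally show ?thesis .
qed

lemma matrix_trace_scalar:
  assumes "c \<in> carrier R"
  shows "matrix_trace R n (scalar_matrix R n c) = add_pow R n c"
proof -
  have "matrix_trace R n (scalar_matrix R n c) = (\<Oplus>i\<in>{..<n}. c)"
    unfolding matrix_trace_def using assms by (intro finsum_cong') (auto simp: matrix_ring_simps(6))
  then show ?thesis using add.finprod_const[OF assms, of "{..<n}"] by simp
qed

end

section \<open>Splittings by self-centralizing subfields\<close>

locale self_centralizing_subfield = skew_field +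
  fixes L :: "'a set"
  assumes L_subfield: "subfield L R" and centre_subset: "centre R \<subseteq> L"
    and centralizer: "\<lbrakk>x \<in> carrier R; \<And>l. l \<in> L \<Longrightarrow> l \<otimes> x = x \<otimes> l\<rbrakk> \<Longrightarrow> x \<in> L"
begin

sublocale id: skew_field_embedding R L "\<lambda>x. x"
  by (intro skew_field_embedding.intro skew_field_axioms skew_field_embedding_axioms.intro
      L_subfield centre_subset refl) (rule subfieldD(4)[OF L_subfield])

lemmas LD = subfieldD[OF L_subfield]

text \<open>A copy of \<open>L\<close> in the unextended record type \<open>'a ring\<close> that
  \<open>splitting\<close> requires; \<open>R\<lparr>carrier := L\<rparr>\<close> would keep the
  scheme type of \<open>R\<close>.\<close>

definition L_field :: "'a ring" where
  "L_field = \<lparr>carrier = L, monoid.mult = (\<otimes>), one = \<one>, ring.zero = \<zero>, ring.add = (\<oplus>)\<rparr>"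

lemma L_field_simps [simp]:
  "carrier L_field = L" "x \<otimes>\<^bsub>L_field\<^esub> y = x \<otimes> y" "x \<oplus>\<^bsub>L_field\<^esub> y = x \<oplus> y"
  "\<one>\<^bsub>L_field\<^esub> = \<one>" "\<zero>\<^bsub>L_field\<^esub> = \<zero>"
  by (simp_all add: L_field_def)

sublocale F: field L_field
proof -
  interpret K: field "R\<lparr>carrier := L\<rparr>" by (rule subfield_iff(2)[OF L_subfield])
  have "id \<in> ring_iso (R\<lparr>carrier := L\<rparr>) L_field"
    by (intro ring_iso_memI) auto
  from K.ring_iso_imp_img_field[OF this] show "field L_field" by (simp add: L_field_def)
qed

lemma finsum_L_field:
  assumes "f \<in> A \<rightarrow> L"
  shows "finsum L_field f A = finsum R f A"
proof (cases "finite A")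
  case True
  then show ?thesis using assms
  proof (induction A rule: finite_induct)
    case (insert a A)
    then have "finsum L_field f (insert a A) = f a \<oplus> finsum L_field f A"
      by (subst F.finsum_insert) auto
    also have "\<dots> = finsum R f (insert a A)"
      using insert LD(4) by (subst finsum_insert) auto
    finally show ?case .
  qed simp
qed (simp add: finsum_infinite F.finsum_infinite)

lemma add_pow_L_field: "c \<in> L \<Longrightarrow> add_pow L_field (m::nat) c = add_pow R m c"
  using F.add.finprod_const[of c "{..<m}"] add.finprod_const[of c "{..<m}"]
    finsum_L_field[of "\<lambda>_. c" "{..<m}"] LD(4) by simp

end

lemma (in ring) combine_finsum:
  assumes "set us \<subseteq> carrier R" "g \<in> {..<length us} \<rightarrow> carrier R"
  shows "combine (map g [0..<length us]) us = (\<Oplus>j\<in>{..<length us}. g j \<otimes> us ! j)"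
  using assms
proof (induction us arbitrary: g)
  case (Cons u us)
  let ?m = "length us"
  let ?h = "\<lambda>j. g j \<otimes> (u # us) ! j"
  have "us ! j \<in> carrier R" if "j < ?m" for j
    using nth_mem[OF that] Cons.prems(1) by auto
  then have h: "?h \<in> {..<Suc ?m} \<rightarrow> carrier R"
    using Cons.prems by (auto simp: less_Suc_eq_0_disj Pi_iff intro!: m_closed)
  have h_Suc: "?h (Suc j) \<in> carrier R" if "j < ?m" for j
    using funcset_mem[OF h, of "Suc j"] that by simp
  have "combine (map g [0..<length (u # us)]) (u # us) = g 0 \<otimes> u \<oplus> combine (map (\<lambda>j. g (Suc j)) [0..<?m]) us"
    by (simp add: upt_conv_Cons map_Suc_upt[symmetric] comp_def del: upt_Suc)
  also have "combine (map (\<lambda>j. g (Suc j)) [0..<?m]) us = (\<Oplus>j\<in>{..<?m}. ?h (Suc j))"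
    using Cons.IH[of "\<lambda>j. g (Suc j)"] Cons.prems by (auto simp: Pi_iff)
  also have "\<dots> = finsum R ?h (Suc ` {..<?m})"
    using h_Suc by (intro finsum_reindex[symmetric]) auto
  also have "g 0 \<otimes> u \<oplus> \<dots> = finsum R ?h (insert 0 (Suc ` {..<?m}))"
    using h_Suc funcset_mem[OF h, of 0] by (subst finsum_insert) auto
  finally show ?case by (simp add: lessThan_Suc_eq_insert_0)
qed simp

section \<open>The splitting by right multiplication\<close>

locale based_self_centralizing_subfield = self_centralizing_subfield +
  fixes us bs :: "'a list"
  assumes us_independent: "independent L us" and us_Span: "Span L us = carrier R"
    and bs_independent: "independent (centre R) bs" and bs_Span: "Span (centre R) bs = carrier R"
begin

abbreviation "r \<equiv> length us"
abbreviation "M \<equiv> matrix_ring L_field r"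
abbreviation "scal \<equiv> scalar_matrix L_field r"

sublocale M: ring M
  by (rule F.matrix_ring_is_ring)

lemma us_carrier: "set us \<subseteq> carrier R" and bs_carrier: "set bs \<subseteq> carrier R"
  using independent_in_carrier us_independent bs_independent by auto

lemma us_nth [simp]: "i < r \<Longrightarrow> us ! i \<in> carrier R"
  using us_carrier nth_mem by blast

lemma r_pos: "0 < r"
proof (rule ccontr)
  assume "\<not> 0 < r"
  then have "carrier R = {\<zero>}" using us_Span by simp
  then show False using one_closed by force
qed

lemma entry_L [simp]: "\<lbrakk>A \<in> carrier M; i < r; j < r\<rbrakk> \<Longrightarrow> A (i, j) \<in> L"
  using F.matrix_entry_closed by simp

lemma entry_carrier [simp]: "\<lbrakk>A \<in> carrier M; i < r; j < r\<rbrakk> \<Longrightarrow> A (i, j) \<in> carrier R"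
  using entry_L LD(4) by blast

text \<open>As \<open>us\<close> is an \<open>L\<close>-basis, the values \<open>act A i\<close>
  determine \<open>A\<close>, so identities between matrices over \<open>L\<close> can be checked as
  identities in \<open>R\<close>.\<close>

definition act :: "(nat \<times> nat \<Rightarrow> 'a) \<Rightarrow> nat \<Rightarrow> 'a" where
  "act A i = (\<Oplus>j\<in>{..<r}. A (i, j) \<otimes> us ! j)"

lemma act_closed [simp]: "\<lbrakk>A \<in> carrier M; i < r\<rbrakk> \<Longrightarrow> act A i \<in> carrier R"
  by (auto simp: act_def intro!: finsum_closed)

lemma coordinates_unique:
  assumes "f \<in> {..<r} \<rightarrow> L" "g \<in> {..<r} \<rightarrow> L"
    and "(\<Oplus>j\<in>{..<r}. f j \<otimes> us ! j) = (\<Oplus>j\<in>{..<r}. g j \<otimes> us ! j)" "j < r"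
  shows "f j = g j"
proof -
  have c: "f \<in> {..<r} \<rightarrow> carrier R" "g \<in> {..<r} \<rightarrow> carrier R" using assms LD(4) by auto
  let ?a = "combine (map f [0..<r]) us"
  have "?a \<in> Span L us"
    unfolding us_Span using c us_carrier by (intro combine_in_carrier) (auto simp: Pi_iff)
  moreover have "?a = combine (map g [0..<r]) us"
    using combine_finsum[OF us_carrier c(1)] combine_finsum[OF us_carrier c(2)] assms(3) by simp
  moreover have "set (map f [0..<r]) \<subseteq> L" "set (map g [0..<r]) \<subseteq> L"
    using assms(1,2) by (auto simp: Pi_iff)
  moreover have "length (map f [0..<r]) = r" "length (map g [0..<r]) = r" by simp_all
  ultimately have "map f [0..<r] = map g [0..<r]"
    using unique_decomposition[OF L_subfield us_independent, of ?a] by blast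
  then show ?thesis using assms(4) by simp
qed

lemma coordinates_exist:
  assumes "x \<in> carrier R"
  shows "\<exists>f. f \<in> {..<r} \<rightarrow> L \<and> x = (\<Oplus>j\<in>{..<r}. f j \<otimes> us ! j)"
proof -
  obtain ks where ks: "set ks \<subseteq> L" "length ks = r" "x = combine ks us"
    using Span_mem_iff_length_version[OF L_subfield us_carrier, of x] us_Span assms by auto
  have "(!) ks \<in> {..<r} \<rightarrow> L" using ks by auto
  moreover have "combine ks us = (\<Oplus>j\<in>{..<r}. ks ! j \<otimes> us ! j)"
    using combine_finsum[OF us_carrier, of "(!) ks"] calculation LD(4) ks(2) map_nth[of ks] by (auto simp: Pi_iff)
  ultimately show ?thesis using ks(3) by blast
qed

lemma act_inject:
  assumes "A \<in> carrier M" "A' \<in> carrier M" "\<And>i. i < r \<Longrightarrow> act A i = act A' i"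
  shows "A = A'"
proof (rule F.matrix_eqI[OF assms(1,2)])
  fix i j assume ij: "i < r" "j < r"
  show "A (i, j) = A' (i, j)"
    by (rule coordinates_unique[of "\<lambda>j. A (i, j)" "\<lambda>j. A' (i, j)"])
      (use assms ij in \<open>auto simp: act_def\<close>)
qed

lemma act_add:
  assumes "A \<in> carrier M" "A' \<in> carrier M" "i < r"
  shows "act (A \<oplus>\<^bsub>M\<^esub> A') i = act A i \<oplus> act A' i"
proof -
  have "act (A \<oplus>\<^bsub>M\<^esub> A') i = (\<Oplus>j\<in>{..<r}. A (i, j) \<otimes> us ! j \<oplus> A' (i, j) \<otimes> us ! j)"
    unfolding act_def using assms by (intro finsum_cong') (auto simp: F.matrix_ring_simps(3) l_distr)
  also have "\<dots> = act A i \<oplus> act A' i"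
    unfolding act_def using assms by (intro finsum_addf) auto
  finally show ?thesis .
qed

lemma act_zero: "i < r \<Longrightarrow> act \<zero>\<^bsub>M\<^esub> i = \<zero>"
  using act_add[of "\<zero>\<^bsub>M\<^esub>" "\<zero>\<^bsub>M\<^esub>" i] by simp

lemma act_mult:
  assumes "A \<in> carrier M" "A' \<in> carrier M" "i < r"
  shows "act (A \<otimes>\<^bsub>M\<^esub> A') i = (\<Oplus>l\<in>{..<r}. A (i, l) \<otimes> act A' l)"
proof -
  have e: "(A \<otimes>\<^bsub>M\<^esub> A') (i, j) = (\<Oplus>l\<in>{..<r}. A (i, l) \<otimes> A' (l, j))" if "j < r" for j
    using F.matrix_ring_simps(2)[OF assms(3) that, of A A'] assms that
    by (subst (asm) finsum_L_field) (auto simp: LD(8))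
  have "act (A \<otimes>\<^bsub>M\<^esub> A') i = (\<Oplus>j\<in>{..<r}. \<Oplus>l\<in>{..<r}. A (i, l) \<otimes> A' (l, j) \<otimes> us ! j)"
    unfolding act_def using assms by (intro finsum_cong') (auto simp: e intro!: finsum_ldistr finsum_closed)
  also have "\<dots> = (\<Oplus>l\<in>{..<r}. \<Oplus>j\<in>{..<r}. A (i, l) \<otimes> A' (l, j) \<otimes> us ! j)"
    using assms by (intro finsum_swap) auto
  also have "\<dots> = (\<Oplus>l\<in>{..<r}. \<Oplus>j\<in>{..<r}. A (i, l) \<otimes> (A' (l, j) \<otimes> us ! j))"
    using assms by (simp add: m_assoc cong: finsum_cong)
  also have "\<dots> = (\<Oplus>l\<in>{..<r}. A (i, l) \<otimes> act A' l)"
    using assms unfolding act_def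
    by (intro finsum_cong') (auto intro!: finsum_rdistr[symmetric] finsum_closed)
  finally show ?thesis .
qed

lemma act_scalar_mult:
  assumes "A \<in> carrier M" "c \<in> L" "i < r"
  shows "act (scal c \<otimes>\<^bsub>M\<^esub> A) i = c \<otimes> act A i"
proof -
  have "act (scal c \<otimes>\<^bsub>M\<^esub> A) i = (\<Oplus>j\<in>{..<r}. c \<otimes> (A (i, j) \<otimes> us ! j))"
    unfolding act_def using assms LD(4) F.scalar_mult_entry[OF assms(1) _ assms(3)]
    by (intro finsum_cong') (auto simp: m_assoc)
  also have "\<dots> = c \<otimes> act A i"
    unfolding act_def using assms LD(4) by (intro finsum_rdistr[symmetric]) auto
  finally show ?thesis .
qed

lemma act_one: "i < r \<Longrightarrow> act \<one>\<^bsub>M\<^esub> i = us ! i"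
proof -
  assume i: "i < r"
  have "act \<one>\<^bsub>M\<^esub> i = (\<Oplus>j\<in>{..<r}. if i = j then us ! j else \<zero>)"
    unfolding act_def using i by (intro finsum_cong') (auto simp: F.matrix_ring_simps(4))
  also have "\<dots> = us ! i" using i by (intro finsum_singleton) auto
  finally show ?thesis .
qed

text \<open>The matrix of right multiplication by \<open>b\<close> on the left \<open>L\<close>-space \<open>R\<close>, with coordinates written
  in rows, so that products are not reversed.\<close>

definition rho :: "'a \<Rightarrow> nat \<times> nat \<Rightarrow> 'a" where
  "rho b = (\<lambda>(i, j) \<in> {..<r} \<times> {..<r}.
     (SOME f. f \<in> {..<r} \<rightarrow> L \<and> us ! i \<otimes> b = (\<Oplus>j\<in>{..<r}. f j \<otimes> us ! j)) j)"

lemma rho_row: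
  assumes "b \<in> carrier R" "i < r"
  shows "(\<lambda>j. rho b (i, j)) \<in> {..<r} \<rightarrow> L" "act (rho b) i = us ! i \<otimes> b"
proof -
  let ?P = "\<lambda>f. f \<in> {..<r} \<rightarrow> L \<and> us ! i \<otimes> b = (\<Oplus>j\<in>{..<r}. f j \<otimes> us ! j)"
  define f where "f = (SOME f. ?P f)"
  have f: "?P f"
    unfolding f_def using coordinates_exist[of "us ! i \<otimes> b"] assms by (intro someI_ex[where P = ?P]) auto
  have rho: "rho b (i, j) = f j" if "j < r" for j
    using assms that by (simp add: rho_def f_def)
  show "(\<lambda>j. rho b (i, j)) \<in> {..<r} \<rightarrow> L" using f rho by auto
  have "act (rho b) i = (\<Oplus>j\<in>{..<r}. f j \<otimes> us ! j)"
    unfolding act_def using f rho LD(4) by (intro finsum_cong') (auto simp: Pi_iff)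
  then show "act (rho b) i = us ! i \<otimes> b" using f by simp
qed

lemma rho_closed [simp]: "b \<in> carrier R \<Longrightarrow> rho b \<in> carrier M"
  using rho_row(1) by (auto simp: F.matrix_ring_simps(1) rho_def Pi_iff)

lemma rho_eqI:
  assumes "b \<in> carrier R" "A \<in> carrier M" "\<And>i. i < r \<Longrightarrow> act A i = us ! i \<otimes> b"
  shows "rho b = A"
  using assms by (intro act_inject) (auto simp: rho_row)

lemma rho_hom: "rho \<in> ring_hom R M"
proof (rule ring_hom_memI)
  fix b b' assume b: "b \<in> carrier R" "b' \<in> carrier R"
  show "rho (b \<oplus> b') = rho b \<oplus>\<^bsub>M\<^esub> rho b'"
    using b by (intro rho_eqI) (auto simp: act_add rho_row r_distr)
  show "rho (b \<otimes> b') = rho b \<otimes>\<^bsub>M\<^esub> rho b'"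
  proof (rule rho_eqI)
    fix i assume i: "i < r"
    have "act (rho b \<otimes>\<^bsub>M\<^esub> rho b') i = (\<Oplus>l\<in>{..<r}. rho b (i, l) \<otimes> (us ! l \<otimes> b'))"
      using b i act_mult[of "rho b" "rho b'" i] by (auto simp: rho_row cong: finsum_cong)
    also have "\<dots> = (\<Oplus>l\<in>{..<r}. rho b (i, l) \<otimes> us ! l \<otimes> b')"
      using b i by (simp add: m_assoc cong: finsum_cong)
    also have "\<dots> = act (rho b) i \<otimes> b'"
      unfolding act_def using b i by (intro finsum_ldistr[symmetric]) auto
    finally show "act (rho b \<otimes>\<^bsub>M\<^esub> rho b') i = us ! i \<otimes> (b \<otimes> b')"
      using b i by (simp add: rho_row m_assoc)
  qed (use b in auto)
qed (auto intro!: rho_eqI simp: act_one)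

lemma rho_centre:
  assumes "z \<in> centre R"
  shows "rho z = scal z"
proof (rule rho_eqI)
  have z: "z \<in> carrier R" "z \<in> L" using assms centre_subset LD(4) by auto
  then show "z \<in> carrier R" "scal z \<in> carrier M" by auto
  fix i assume i: "i < r"
  have "scal z \<otimes>\<^bsub>M\<^esub> \<one>\<^bsub>M\<^esub> = scal z" using z by (intro M.r_one) auto
  then show "act (scal z) i = us ! i \<otimes> z"
    using act_scalar_mult[of "\<one>\<^bsub>M\<^esub>" z i] act_one z i centre_commute[OF assms, of "us ! i"] by simp
qed

text \<open>The bridge to operators: a linear combination of the matrices \<open>rho c\<close> acts
  on the basis vectors as the operator with the same coefficients does.\<close>

lemma act_combine:
  assumes "set ls \<subseteq> L" "set cs \<subseteq> carrier R" "i < r"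
  shows "act (M.combine (map scal ls) (map rho cs)) i = combine (map (\<lambda>l. l \<otimes> us ! i) ls) cs"
  using assms(1,2)
proof (induction ls cs rule: list_induct2')
  case (4 l ls c cs)
  have cl: "M.combine (map scal ls) (map rho cs) \<in> carrier M"
    using "4.prems" by (intro M.combine_in_carrier) auto
  have l: "l \<in> L" "l \<in> carrier R" "c \<in> carrier R" using "4.prems" LD(4) by auto
  show ?case
    using 4 cl l assms(3) by (simp add: act_add act_scalar_mult rho_row m_assoc)
qed (use act_zero assms(3) in simp_all)

lemma tensor_op_combine_left:
  assumes "set ls \<subseteq> L" "set cs \<subseteq> carrier R"
  shows "\<exists>g. id.tensor_op (\<lambda>x. combine (map (\<lambda>l. l \<otimes> x) ls) cs) g"
  using assms
proof (induction ls cs rule: list_induct2')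
  case (4 l ls c cs)
  then obtain g where g: "id.tensor_op (\<lambda>x. combine (map (\<lambda>l. l \<otimes> x) ls) cs) g" by auto
  have "id.tensor_op (\<lambda>x. l \<otimes> x \<otimes> c) (\<lambda>x. l \<otimes> x \<otimes> c)" using 4 by (intro id.tensor_op.pure) auto
  from id.tensor_op.plus[OF this g] show ?case by auto
\<comment> \<open>When a list is exhausted \<open>combine\<close> returns zero, which is the pure
  operator with both factors zero.\<close>
qed (simp_all, (intro exI[of _ "\<lambda>_. \<zero>"] id.tensor_op.agree[OF id.tensor_op.pure[of \<zero> \<zero>]];
    simp add: LD(2))+)

text \<open>A relation among the matrices is an operator killing \<open>us\<close>, hence all of
  \<open>R\<close> by \<open>L\<close>-linearity; \<open>combine_central_zero\<close> then makes its
  coefficients zero.\<close>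

lemma rho_independent: "M.independent (scal ` L) (map rho bs)"
proof (rule M.trivial_combine_imp_independent)
  show K: "subfield (scal ` L) M" using F.scalar_matrices_subfield[OF r_pos] by simp
  show rb: "set (map rho bs) \<subseteq> carrier M" using bs_carrier by auto
  fix Ks assume Ks: "set Ks \<subseteq> scal ` L" "M.combine Ks (map rho bs) = \<zero>\<^bsub>M\<^esub>"
  have "set Ks \<subseteq> carrier M" using Ks(1) by auto
  \<comment> \<open>The list \<open>Ks\<close> may have any length; it is cut or padded with zeros
    to the length of \<open>bs\<close>. The padding stays among the scalar matrices because
    \<open>scal \<zero>\<close> is the zero matrix.\<close>
  from M.combine_normalize[OF this rb Ks(2)] obtain Ks' where
    Ks': "set (take (length (map rho bs)) Ks) \<subseteq> set Ks'"
      "set Ks' \<subseteq> set (take (length (map rho bs)) Ks) \<union> {\<zero>\<^bsub>M\<^esub>}"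
      "length Ks' = length (map rho bs)" "M.combine Ks' (map rho bs) = \<zero>\<^bsub>M\<^esub>" by metis
  have "scal \<zero> = \<zero>\<^bsub>M\<^esub>" using LD(2) by (intro F.matrix_eqI[where n = r]) (auto simp: F.matrix_ring_simps(5,6))
  then have "\<zero>\<^bsub>M\<^esub> \<in> scal ` L" using LD(2) by force
  then have "set Ks' \<subseteq> scal ` L" using Ks'(2) Ks(1) set_take_subset[of _ Ks] by blast
  then obtain ls where ls: "set ls \<subseteq> L" "Ks' = map scal ls"
    using lists_image[of scal L] unfolding lists_eq_set by blast
  have len: "length ls = length bs" using Ks'(3) ls(2) by simp
  obtain g where g: "id.tensor_op (\<lambda>x. combine (map (\<lambda>l. l \<otimes> x) ls) bs) g"
    using tensor_op_combine_left[OF ls(1) bs_carrier] by blast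
  have zero: "combine (map (\<lambda>l. l \<otimes> us ! i) ls) bs = \<zero>" if i: "i < r" for i
    using act_combine[OF ls(1) bs_carrier i] act_zero[OF i] Ks'(4) ls(2) by simp
  have "set ls \<subseteq> {\<zero>}"
  proof (rule combine_central_zero[OF bs_independent len])
    show "set ls \<subseteq> carrier R" using ls(1) LD(1) by blast
    fix x assume x: "x \<in> carrier R"
    obtain ks where ks: "set ks \<subseteq> L" "x = combine ks us"
      using Span_eq_combine_set[OF L_subfield us_carrier] us_Span x by blast
    have "combine (map (\<lambda>l. l \<otimes> x) ls) bs = combine ks (map (\<lambda>x. combine (map (\<lambda>l. l \<otimes> x) ls) bs) us)"
      unfolding ks(2) by (rule id.tensor_op_combine[OF g ks(1) us_carrier])
    also have "map (\<lambda>x. combine (map (\<lambda>l. l \<otimes> x) ls) bs) us = map (\<lambda>_. \<zero>) us"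
      using zero by (auto simp: in_set_conv_nth)
    also have "combine ks (map (\<lambda>_. \<zero>) us) = \<zero>"
      using subset_trans[OF ks(1) LD(1)] by (rule combine_zero_vectors)
    finally show "combine (map (\<lambda>l. l \<otimes> x) ls) bs = \<zero>" .
  qed
  then show "set (take (length (map rho bs)) Ks) \<subseteq> {\<zero>\<^bsub>M\<^esub>}"
    using Ks'(1) ls(2) \<open>scal \<zero> = \<zero>\<^bsub>M\<^esub>\<close> by auto
qed

text \<open>Surjectivity is density: an operator interpolating the values \<open>act A i\<close> on
  the basis has a normal form over \<open>bs\<close>, and its coefficients express \<open>A\<close>
  through the matrices \<open>rho b\<close>.\<close>

lemma rho_Span: "M.Span (scal ` L) (map rho bs) = carrier M"
proof
  have K: "subfield (scal ` L) M" using F.scalar_matrices_subfield[OF r_pos] by simp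
  have rb: "set (map rho bs) \<subseteq> carrier M" using bs_carrier by auto
  show "M.Span (scal ` L) (map rho bs) \<subseteq> carrier M"
    by (rule M.Span_in_carrier) (use rb in auto)
  show "carrier M \<subseteq> M.Span (scal ` L) (map rho bs)"
  proof
    fix A assume A: "A \<in> carrier M"
    have "length (map (act A) [0..<r]) = r" "set (map (act A) [0..<r]) \<subseteq> carrier R" using A by auto
    from id.interpolation[OF centralizer us_independent this]
    obtain f g where f: "id.tensor_op f g" "map f us = map (act A) [0..<r]" by blast
    obtain ls where ls: "set ls \<subseteq> L" "\<And>x. x \<in> carrier R \<Longrightarrow> f x = combine (map (\<lambda>l. l \<otimes> x) ls) bs"
      using id.tensor_op_normal_form[OF f(1) bs_carrier bs_Span] by blast
    have cl: "M.combine (map scal ls) (map rho bs) \<in> carrier M"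
      using rb ls(1) by (intro M.combine_in_carrier) auto
    have "A = M.combine (map scal ls) (map rho bs)"
    proof (rule act_inject[OF A cl])
      fix i assume i: "i < r"
      have "act A i = f (us ! i)" using arg_cong[OF f(2), of "\<lambda>xs. xs ! i"] i by simp
      then show "act A i = act (M.combine (map scal ls) (map rho bs)) i"
        using ls i by (simp add: act_combine bs_carrier)
    qed
    moreover have "set (map scal ls) \<subseteq> scal ` L" using ls(1) by auto
    ultimately show "A \<in> M.Span (scal ` L) (map rho bs)"
      using M.Span_eq_combine_set[OF K rb] by blast
  qed
qed

theorem splitting_rho: "splitting R r L_field (\<lambda>x. x) rho"
  unfolding splitting_def
proof (intro conjI)
  show "field L_field" by (rule F.field_axioms)
  show "(\<lambda>x. x) \<in> ring_hom (R\<lparr>carrier := centre R\<rparr>) L_field"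
    using centre_subset by (intro ring_hom_memI) auto
  show "rho \<in> ring_hom R M" by (rule rho_hom)
  show "\<forall>z\<in>centre R. rho z = scal z" using rho_centre by blast
  show "\<exists>bs. set bs \<subseteq> carrier R \<and> independent (centre R) bs \<and> Span (centre R) bs = carrier R \<and>
      M.independent (scal ` carrier L_field) (map rho bs) \<and>
      M.Span (scal ` carrier L_field) (map rho bs) = carrier M"
    using bs_carrier bs_independent bs_Span rho_independent rho_Span by (intro exI[of _ bs]) simp
qed

text \<open>A basis of \<open>R\<close> over the centre goes to a basis of the matrix ring over
  \<open>L\<close>. This later identifies the dimension of \<open>B\<close> over \<open>L\<close>
  with the degree \<open>n\<close>.\<close>

theorem degree_square: "length bs = r\<^sup>2"
proof -
  have K: "subfield (scal ` L) M" using F.scalar_matrices_subfield[OF r_pos] by simp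
  show ?thesis
    using M.dimension_is_inj[OF K] M.dimensionI[OF K rho_independent rho_Span]
      F.matrix_ring_dimension[OF r_pos] by simp
qed

end

section \<open>The reduced trace on a Galois subfield\<close>

lemma field_autsD:
  fixes R (structure)
  assumes "\<phi> \<in> field_auts R K L"
  shows "\<And>x. x \<in> L \<Longrightarrow> \<phi> x \<in> L"
    "\<And>x y. x \<in> L \<Longrightarrow> y \<in> L \<Longrightarrow> \<phi> (x \<oplus> y) = \<phi> x \<oplus> \<phi> y"
    "\<And>x y. x \<in> L \<Longrightarrow> y \<in> L \<Longrightarrow> \<phi> (x \<otimes> y) = \<phi> x \<otimes> \<phi> y"
    "\<phi> \<one> = \<one>" "\<And>x. x \<in> K \<Longrightarrow> \<phi> x = x" "bij_betw \<phi> L L"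
  using assms ring_iso_memE[of \<phi> "R\<lparr>carrier := L\<rparr>" "R\<lparr>carrier := L\<rparr>"]
  by (auto simp: field_auts_def)

lemma field_autsI:
  fixes R (structure)
  assumes "\<And>x. x \<in> L \<Longrightarrow> \<phi> x \<in> L"
    "\<And>x y. x \<in> L \<Longrightarrow> y \<in> L \<Longrightarrow> \<phi> (x \<oplus> y) = \<phi> x \<oplus> \<phi> y"
    "\<And>x y. x \<in> L \<Longrightarrow> y \<in> L \<Longrightarrow> \<phi> (x \<otimes> y) = \<phi> x \<otimes> \<phi> y"
    "\<phi> \<one> = \<one>" "\<And>x. x \<in> K \<Longrightarrow> \<phi> x = x" "bij_betw \<phi> L L"
  shows "\<phi> \<in> field_auts R K L"
  using assms by (auto simp: field_auts_def intro!: ring_iso_memI)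

lemma field_auts_comp:
  assumes "\<phi> \<in> field_auts R K L" "\<phi>' \<in> field_auts R K L" "K \<subseteq> L"
  shows "(\<lambda>x. \<phi> (\<phi>' x)) \<in> field_auts R K L"
proof (rule field_autsI)
  show "bij_betw (\<lambda>x. \<phi> (\<phi>' x)) L L"
    using bij_betw_trans[OF field_autsD(6)[OF assms(2)] field_autsD(6)[OF assms(1)]] by (simp add: comp_def)
qed (use assms field_autsD[OF assms(1)] field_autsD[OF assms(2)] in auto)

context ring
begin

text \<open>Traces of arbitrary splittings enter the argument only through these four facts.\<close>

lemma splitting_trace:
  assumes "splitting R n F \<iota> \<rho>"
  defines "\<theta> \<equiv> \<lambda>b. matrix_trace F n (\<rho> b)"
  shows "\<And>b. b \<in> carrier R \<Longrightarrow> \<theta> b \<in> carrier F"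
    "\<And>b c. b \<in> carrier R \<Longrightarrow> c \<in> carrier R \<Longrightarrow> \<theta> (b \<oplus> c) = \<theta> b \<oplus>\<^bsub>F\<^esub> \<theta> c"
    "\<And>b c. b \<in> carrier R \<Longrightarrow> c \<in> carrier R \<Longrightarrow> \<theta> (b \<otimes> c) = \<theta> (c \<otimes> b)"
    "\<And>z. z \<in> centre R \<Longrightarrow> \<theta> z = add_pow F n (\<iota> z)"
proof -
  interpret F: field F using assms(1) by (simp add: splitting_def)
  have \<rho>: "\<rho> \<in> ring_hom R (matrix_ring F n)"
    and z: "\<And>z. z \<in> centre R \<Longrightarrow> \<rho> z = scalar_matrix F n (\<iota> z)"
    and \<iota>: "\<iota> \<in> ring_hom (R\<lparr>carrier := centre R\<rparr>) F"
    using assms(1) by (simp_all add: splitting_def)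
  note h = ring_hom_memE[OF \<rho>]
  show "\<theta> b \<in> carrier F" if "b \<in> carrier R" for b
    using that h by (simp add: \<theta>_def)
  show "\<theta> (b \<oplus> c) = \<theta> b \<oplus>\<^bsub>F\<^esub> \<theta> c" if "b \<in> carrier R" "c \<in> carrier R" for b c
    using that h F.matrix_trace_add by (simp add: \<theta>_def)
  show "\<theta> (b \<otimes> c) = \<theta> (c \<otimes> b)" if "b \<in> carrier R" "c \<in> carrier R" for b c
    using that h F.matrix_trace_mult_comm by (simp add: \<theta>_def)
  show "\<theta> z = add_pow F n (\<iota> z)" if "z \<in> centre R" for z
    using that z ring_hom_memE(1)[OF \<iota>] F.matrix_trace_scalar by (simp add: \<theta>_def)
qed

end

text \<open>\<open>char_zero\<close> will be supplied by the ordering; it permits division by the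
  order of the Galois group.\<close>

locale galois_self_centralizing_subfield = based_self_centralizing_subfield +
  assumes galois: "galois_extension R (centre R) L"
    and char_zero: "0 < m \<Longrightarrow> add_pow R (m::nat) \<one> \<noteq> \<zero>"
begin

section \<open>The Galois group and its conjugating elements\<close>

abbreviation "G \<equiv> field_auts R (centre R) L"

text \<open>Members of \<open>G\<close> have arbitrary values off \<open>L\<close>, so one
  automorphism has many representatives. Restriction keeps one of each, which makes counting and
  summing meaningful.\<close>

definition restricted_auts :: "('a \<Rightarrow> 'a) set" where
  "restricted_auts = (\<lambda>\<phi>. restrict \<phi> L) ` G"

lemma fixed_field: "x \<in> L \<Longrightarrow> (\<And>\<phi>. \<phi> \<in> G \<Longrightarrow> \<phi> x = x) \<Longrightarrow> x \<in> centre R"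
  using galois unfolding galois_extension_def by blast

lemma aut_inner:
  assumes "\<phi> \<in> G"
  shows "\<exists>y. y \<in> carrier R \<and> y \<noteq> \<zero> \<and> (\<forall>l\<in>L. \<phi> l \<otimes> y = y \<otimes> l)"
proof -
  note \<phi> = field_autsD[OF assms]
  interpret e: skew_field_embedding R L \<phi>
    by (intro skew_field_embedding.intro skew_field_axioms skew_field_embedding_axioms.intro
      L_subfield centre_subset) (rule LD(4)[OF \<phi>(1)] \<phi>(2) \<phi>(3) \<phi>(5); assumption)+
  show ?thesis using e.skolem_noether[OF bs_independent bs_Span] by (simp only: Bex_def)
qed

lemma restricted_inner:
  assumes "f \<in> restricted_auts"
  shows "\<exists>y. y \<in> carrier R \<and> y \<noteq> \<zero> \<and> (\<forall>l\<in>L. f l \<otimes> y = y \<otimes> l)"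
proof -
  obtain \<phi> where \<phi>: "\<phi> \<in> G" and f: "f = restrict \<phi> L"
    using assms unfolding restricted_auts_def by blast
  have "f l = \<phi> l" if "l \<in> L" for l using that by (simp add: f)
  with aut_inner[OF \<phi>] show ?thesis by metis
qed

lemma restricted_closed:
  assumes "f \<in> restricted_auts" "l \<in> L"
  shows "f l \<in> L"
proof -
  obtain \<phi> where "\<phi> \<in> G" "f = restrict \<phi> L"
    using assms(1) unfolding restricted_auts_def by blast
  then show ?thesis using field_autsD(1)[of \<phi> R "centre R" L l] assms(2) by simp
qed

lemma restricted_extensional: "f \<in> restricted_auts \<Longrightarrow> f \<in> extensional L"
  unfolding restricted_auts_def by auto

definition conjugator :: "('a \<Rightarrow> 'a) \<Rightarrow> 'a" where
  "conjugator f = (SOME y. y \<in> carrier R \<and> y \<noteq> \<zero> \<and> (\<forall>l\<in>L. f l \<otimes> y = y \<otimes> l))"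

lemma conjugator:
  assumes "f \<in> restricted_auts"
  shows "conjugator f \<in> carrier R" "conjugator f \<noteq> \<zero>"
    "l \<in> L \<Longrightarrow> f l \<otimes> conjugator f = conjugator f \<otimes> l"
  using someI_ex[OF restricted_inner[OF assms]] unfolding conjugator_def by auto

text \<open>Each conjugator is an eigenvector of right multiplication by \<open>l\<close>, with
  eigenvalue \<open>f l\<close> acting from the left.\<close>

lemma combine_conjugators:
  assumes "set fs \<subseteq> restricted_auts" "set ks \<subseteq> L" "length ks = length fs" "l \<in> L"
  shows "combine ks (map conjugator fs) \<otimes> l
    = combine (map2 (\<lambda>k f. k \<otimes> f l) ks fs) (map conjugator fs)"
  using assms(3,1,2)
proof (induction ks fs rule: list_induct2)
  case Nil
  then show ?case using assms(4) LD(4) by simp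
next
  case (Cons k ks f fs)
  have c: "combine ks (map conjugator fs) \<in> carrier R"
    using Cons.prems conjugator(1) LD(4) by (intro combine_in_carrier) auto
  have f: "f l \<in> carrier R" "k \<in> carrier R" "l \<in> carrier R" "conjugator f \<in> carrier R"
    using Cons.prems assms(4) restricted_closed conjugator(1) LD(4) by auto
  have "k \<otimes> conjugator f \<otimes> l = k \<otimes> f l \<otimes> conjugator f"
    using f conjugator(3)[of f l] Cons.prems assms(4) by (simp add: m_assoc)
  then show ?case using Cons c f by (simp add: l_distr)
qed

text \<open>Dedekind's argument. If \<open>conjugator f\<close> is a combination of the others,
  multiply by \<open>f l\<close> on the left and by \<open>l\<close> on the right: the results
  agree, so comparing coordinates gives \<open>f l = (fs ! i) l\<close> wherever the coefficient is
  nonzero. As this holds for all \<open>l\<close>, the two automorphisms coincide.\<close>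

lemma conjugators_independent:
  assumes "distinct fs" "set fs \<subseteq> restricted_auts"
  shows "independent L (map conjugator fs)"
  using assms
proof (induction fs)
  case (Cons f fs)
  let ?Y = "map conjugator fs"
  have ind: "independent L ?Y" using Cons by simp
  have f: "f \<in> restricted_auts" and fs: "set fs \<subseteq> restricted_auts" using Cons.prems by auto
  have Y: "set ?Y \<subseteq> carrier R" using fs conjugator(1) by auto
  have "conjugator f \<notin> Span L ?Y"
  proof
    assume "conjugator f \<in> Span L ?Y"
    from iffD1[OF Span_mem_iff_length_version[OF L_subfield Y] this]
    obtain ks where "set ks \<subseteq> L \<and> length ks = length ?Y \<and> conjugator f = combine ks ?Y" ..
    then have ks: "set ks \<subseteq> L" "length ks = length fs" "conjugator f = combine ks ?Y"
      unfolding length_map by blast+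
    have "k = \<zero>" if k: "k \<in> set ks" for k
    proof (rule ccontr)
      assume k0: "k \<noteq> \<zero>"
      obtain i where i: "i < length ks" "ks ! i = k"
        using k by (auto simp: in_set_conv_nth)
      have kL: "k \<in> L" using subsetD[OF ks(1) k] .
      have fi: "fs ! i \<in> set fs" using i(1) ks(2) by simp
      then have fi': "fs ! i \<in> restricted_auts" using subsetD[OF fs] by simp
      have "f l = (fs ! i) l" if l: "l \<in> L" for l
      proof -
        have fl: "f l \<in> L" using restricted_closed[OF f l] .
        let ?P = "\<lambda>Ks. set Ks \<subseteq> L \<and> length Ks = length ?Y \<and> conjugator f \<otimes> l = combine Ks ?Y"
        have kc: "set ks \<subseteq> carrier R" using subset_trans[OF ks(1) LD(1)] .
        have "f l \<otimes> conjugator f = combine (map ((\<otimes>) (f l)) ks) ?Y"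
          unfolding ks(3) by (rule combine_r_distr[OF kc Y LD(4)[OF fl]])
        then have 1: "?P (map ((\<otimes>) (f l)) ks)"
          using conjugator(3)[OF f l] ks(1,2) fl LD(8) by auto
        have "k \<otimes> f' l \<in> L" if "(k, f') \<in> set (zip ks fs)" for k f'
          using set_zip_leftD[OF that] set_zip_rightD[OF that] ks(1) fs restricted_closed l LD(8) by blast
        then have 2: "?P (map2 (\<lambda>k f. k \<otimes> f l) ks fs)"
          using combine_conjugators[OF fs ks(1,2) l] ks(2,3) by auto
        have "conjugator f \<otimes> l \<in> Span L ?Y"
          using 1 Span_mem_iff_length_version[OF L_subfield Y] by blast
        then have "map ((\<otimes>) (f l)) ks = map2 (\<lambda>k f. k \<otimes> f l) ks fs"
          using unique_decomposition[OF L_subfield ind] 1 2 by blast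
        from arg_cong[OF this, of "\<lambda>xs. xs ! i"]
        have "f l \<otimes> k = k \<otimes> (fs ! i) l" using i ks(2) by simp
        moreover have gl: "(fs ! i) l \<in> L" using restricted_closed[OF fi' l] .
        ultimately have "k \<otimes> f l = k \<otimes> (fs ! i) l" using LD(9)[OF fl kL] by simp
        then have "inv k \<otimes> (k \<otimes> f l) = inv k \<otimes> (k \<otimes> (fs ! i) l)" by simp
        then show ?thesis using LD(4)[OF kL] k0 LD(4)[OF fl] LD(4)[OF gl] by simp
      qed
      then have "f = fs ! i"
        using restricted_extensional[OF f] restricted_extensional[OF fi'] by (intro extensionalityI) auto
      with fi Cons.prems(1) show False by simp
    qed
    then have "conjugator f = \<zero>" unfolding ks(3) using Y by (intro combine_all_zero) auto
    then show False using conjugator(2)[OF f] by simp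
  qed
  then show ?case using ind conjugator(1)[OF f] by (simp add: li_Cons)
qed simp

text \<open>Distinct automorphisms have independent conjugators, and \<open>R\<close> has dimension
  \<open>r\<close> over \<open>L\<close>; hence there are at most \<open>r\<close> of them.\<close>

lemma finite_restricted_auts: "finite restricted_auts"
proof (rule ccontr)
  assume "infinite restricted_auts"
  then obtain T where T: "finite T" "card T = Suc r" "T \<subseteq> restricted_auts"
    using infinite_arbitrarily_large by blast
  obtain fs where fs: "set fs = T" "distinct fs" using finite_distinct_list[OF T(1)] by blast
  have dim: "dimension r L (carrier R)"
    using dimensionI[OF L_subfield us_independent us_Span] .
  have "independent L (map conjugator fs)" using conjugators_independent fs T(3) by simp
  moreover have "set (map conjugator fs) \<subseteq> carrier R" using fs T(3) conjugator(1) by auto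
  ultimately have "length (map conjugator fs) \<le> r"
    using independent_length_le_dimension[OF L_subfield dim] by blast
  then show False using distinct_card[OF fs(2)] fs(1) T(2) by simp
qed

text \<open>The field trace of \<open>L\<close> over the centre, in its Galois form.\<close>

definition orbit_sum :: "'a \<Rightarrow> 'a" where
  "orbit_sum l = (\<Oplus>f\<in>restricted_auts. f l)"

lemma aut_finsum:
  assumes "\<phi> \<in> G" "g \<in> A \<rightarrow> L" "finite A"
  shows "\<phi> (\<Oplus>a\<in>A. g a) = (\<Oplus>a\<in>A. \<phi> (g a))" "(\<Oplus>a\<in>A. g a) \<in> L"
proof -
  note \<phi> = field_autsD[OF assms(1)]
  have "\<phi> (\<Oplus>a\<in>A. g a) = (\<Oplus>a\<in>A. \<phi> (g a)) \<and> (\<Oplus>a\<in>A. g a) \<in> L"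
    using assms(3,2)
  proof (induction A rule: finite_induct)
    case empty
    show ?case using \<phi>(5) LD(2) subfieldD(2)[OF centre_subfield] by simp
  next
    case (insert a A)
    have "(\<Oplus>x\<in>insert a A. g x) = g a \<oplus> (\<Oplus>x\<in>A. g x)"
      using insert LD(4) by (subst finsum_insert) (auto simp: Pi_iff)
    moreover have "(\<Oplus>x\<in>insert a A. \<phi> (g x)) = \<phi> (g a) \<oplus> (\<Oplus>x\<in>A. \<phi> (g x))"
      using insert LD(4) \<phi>(1) by (subst finsum_insert) (auto simp: Pi_iff)
    ultimately show ?case using insert \<phi>(2) LD(6) by (simp add: Pi_iff)
  qed
  then show "\<phi> (\<Oplus>a\<in>A. g a) = (\<Oplus>a\<in>A. \<phi> (g a))" "(\<Oplus>a\<in>A. g a) \<in> L" by auto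
qed

lemma id_aut: "(\<lambda>x. x) \<in> G"
  by (rule field_autsI) (auto simp: bij_betw_def)

text \<open>Composition with \<phi> permutes the finite set \<open>restricted_auts\<close>, so the
  sum is Galois invariant.\<close>

lemma orbit_sum_centre:
  assumes l: "l \<in> L"
  shows "orbit_sum l \<in> centre R"
proof (rule fixed_field)
  have fl: "(\<lambda>f. f l) \<in> restricted_auts \<rightarrow> L" using restricted_closed l by auto
  show "orbit_sum l \<in> L"
    unfolding orbit_sum_def using aut_finsum(2)[OF id_aut fl finite_restricted_auts] .
  fix \<phi> assume \<phi>: "\<phi> \<in> G"
  define h where "h f = restrict (\<lambda>x. \<phi> (f x)) L" for f
  have h_closed: "h ` restricted_auts \<subseteq> restricted_auts"
  proof
    fix x assume "x \<in> h ` restricted_auts"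
    then obtain \<phi>' where \<phi>': "\<phi>' \<in> G" "x = h (restrict \<phi>' L)" unfolding restricted_auts_def by blast
    have "x = restrict (\<lambda>x. \<phi> (\<phi>' x)) L" unfolding \<phi>'(2) h_def by auto
    then show "x \<in> restricted_auts"
      unfolding restricted_auts_def using field_auts_comp[OF \<phi> \<phi>'(1) centre_subset] by blast
  qed
  have h_inj: "inj_on h restricted_auts"
  proof (rule inj_onI)
    fix f g assume f: "f \<in> restricted_auts" and g: "g \<in> restricted_auts" and eq: "h f = h g"
    show "f = g"
    proof (rule extensionalityI[OF restricted_extensional[OF f] restricted_extensional[OF g]])
      fix x assume x: "x \<in> L"
      have "\<phi> (f x) = \<phi> (g x)" using fun_cong[OF eq, of x] x by (simp add: h_def)
      then show "f x = g x"
        using field_autsD(6)[OF \<phi>] restricted_closed[OF f x] restricted_closed[OF g x]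
        by (auto simp: bij_betw_def inj_on_def)
    qed
  qed
  have img: "h ` restricted_auts = restricted_auts"
    using endo_inj_surj[OF finite_restricted_auts h_closed h_inj] .
  have "\<phi> (orbit_sum l) = (\<Oplus>f\<in>restricted_auts. \<phi> (f l))"
    unfolding orbit_sum_def by (rule aut_finsum(1)[OF \<phi> fl finite_restricted_auts])
  also have "\<dots> = (\<Oplus>f\<in>restricted_auts. (h f) l)"
    using l by (simp add: h_def)
  also have "\<dots> = (\<Oplus>f\<in>h ` restricted_auts. f l)"
    using restricted_closed l LD(4) h_inj img by (intro finsum_reindex[symmetric]) auto
  finally show "\<phi> (orbit_sum l) = orbit_sum l" unfolding img orbit_sum_def .
qed

section \<open>Galois invariance and uniqueness of the reduced trace on L\<close>

text \<open>\<open>f l\<close> is a conjugate of \<open>l\<close> in \<open>R\<close>, and matrix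
  traces do not see conjugation.\<close>

lemma splitting_trace_aut:
  assumes "splitting R n F \<iota> \<rho>" "f \<in> restricted_auts" "l \<in> L"
  shows "matrix_trace F n (\<rho> (f l)) = matrix_trace F n (\<rho> l)"
proof -
  note y = conjugator(1,2)[OF assms(2)] conjugator(3)[OF assms(2,3)]
  have l: "l \<in> carrier R" "f l \<in> carrier R" using assms restricted_closed LD(4) by auto
  have "f l = (conjugator f \<otimes> l) \<otimes> inv (conjugator f)"
    using y l by (simp flip: y(3))
  then show ?thesis
    using splitting_trace(3)[OF assms(1), of "conjugator f \<otimes> l" "inv (conjugator f)"] y l by simp
qed

text \<open>The trace of the orbit sum is computed twice: as a sum of equal traces, and as the trace
  of a scalar matrix.\<close>

lemma splitting_trace_orbit_sum:
  assumes "splitting R n F \<iota> \<rho>" "l \<in> L"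
  shows "add_pow F (card restricted_auts) (matrix_trace F n (\<rho> l)) = add_pow F n (\<iota> (orbit_sum l))"
proof -
  interpret E: field F using assms(1) by (simp add: splitting_def)
  note \<theta> = splitting_trace[OF assms(1)]
  have z: "\<zero> \<in> centre R" "\<zero> \<in> L" using subfieldD(2)[OF centre_subfield] LD(2) by auto
  have "matrix_trace F n (\<rho> \<zero>) \<oplus>\<^bsub>F\<^esub> matrix_trace F n (\<rho> \<zero>) = matrix_trace F n (\<rho> \<zero>)"
    using \<theta>(2)[of \<zero> \<zero>] by simp
  then have \<theta>0: "matrix_trace F n (\<rho> \<zero>) = \<zero>\<^bsub>F\<^esub>" using \<theta>(1)[of \<zero>] by simp
  have l: "l \<in> carrier R" using assms LD(4) by simp
  have "matrix_trace F n (\<rho> (\<Oplus>f\<in>A. f l)) = add_pow F (card A) (matrix_trace F n (\<rho> l))"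
    if "finite A" "A \<subseteq> restricted_auts" for A
    using that
  proof (induction A rule: finite_induct)
    case empty
    show ?case using \<theta>0 by simp
  next
    case (insert f A)
    have fl: "f' l \<in> carrier R" if "f' \<in> insert f A" for f'
      using that insert.prems restricted_closed assms(2) LD(4) by blast
    then have "(\<Oplus>f\<in>insert f A. f l) = f l \<oplus> (\<Oplus>f\<in>A. f l)"
      using insert by (subst finsum_insert) auto
    moreover have "(\<Oplus>f\<in>A. f l) \<in> carrier R" using fl by (intro finsum_closed) auto
    ultimately have "matrix_trace F n (\<rho> (\<Oplus>f\<in>insert f A. f l))
        = matrix_trace F n (\<rho> l) \<oplus>\<^bsub>F\<^esub> add_pow F (card A) (matrix_trace F n (\<rho> l))"
      using \<theta>(2) fl insert splitting_trace_aut[OF assms(1) _ assms(2)] by simp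
    then show ?case using insert \<theta>(1)[OF l] by (simp add: E.a_comm)
  qed
  from this[OF finite_restricted_auts order_refl] show ?thesis
    using \<theta>(4)[OF orbit_sum_centre[OF assms(2)]] by (simp add: orbit_sum_def)
qed

lemma add_pow_cancel:
  assumes "x \<in> carrier R" "y \<in> carrier R" "0 < m" "add_pow R (m::nat) x = add_pow R m y"
  shows "x = y"
proof -
  have "add_pow R m \<one> \<otimes> x = add_pow R m \<one> \<otimes> y"
    using assms by (simp add: add_pow_ldistr)
  moreover have "add_pow R m \<one> \<in> carrier R" "add_pow R m \<one> \<noteq> \<zero>" using char_zero[OF assms(3)] by auto
  ultimately show ?thesis using assms(1,2) inv_cancel(1) by metis
qed

lemma card_restricted_auts: "0 < card restricted_auts"
  using id_aut finite_restricted_auts unfolding restricted_auts_def by (auto simp: card_gt_0_iff)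

text \<open>Since \<open>restricted_auts\<close> consists of inner automorphisms, the trace of \<open>l\<close> in any splitting is
  determined by the central element \<open>orbit_sum l\<close>.\<close>

theorem reduced_trace_eq:
  assumes l: "l \<in> L"
  shows "reduced_trace R r l = matrix_trace L_field r (rho l)" (is "_ = ?t")
    and "matrix_trace L_field r (rho l) \<in> centre R"
proof -
  let ?m = "card restricted_auts"
  let ?T = "orbit_sum l"
  have lc: "l \<in> carrier R" using l LD(4) by simp
  have T: "?T \<in> centre R" "?T \<in> L" "?T \<in> carrier R"
    using orbit_sum_centre[OF l] centre_subset LD(4) by auto
  have t: "?t \<in> L" "?t \<in> carrier R" using splitting_trace(1)[OF splitting_rho lc] LD(4) by auto
  have eq: "add_pow R ?m ?t = add_pow R r ?T"
    using splitting_trace_orbit_sum[OF splitting_rho l] t T by (simp add: add_pow_L_field)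
  have "?t \<in> centre R"
  proof -
    \<comment> \<open>The group order, read in the centre, is a nonzero central element and can be
      divided out.\<close>
    define q where "q = add_pow R ?m \<one>"
    have q: "q \<in> centre R" "q \<in> carrier R" "q \<noteq> \<zero>"
      using add_pow_subfield[OF centre_subfield subfieldD(3)[OF centre_subfield]]
        char_zero[OF card_restricted_auts] by (auto simp: q_def)
    have "q \<otimes> ?t = add_pow R r ?T" using eq t by (simp add: q_def add_pow_ldistr)
    then have "?t = inv q \<otimes> add_pow R r ?T" using q t inv_cancel(1)[of q ?t] by simp
    also have "\<dots> \<in> centre R"
      using q T(1) add_pow_subfield[OF centre_subfield] subfieldD(8,10)[OF centre_subfield] by blast
    finally show ?thesis .
  qed
  then show "?t \<in> centre R" .
  show "reduced_trace R r l = ?t"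
    unfolding reduced_trace_def
  proof (rule the_equality)
    show "?t \<in> centre R \<and> (\<exists>(F :: 'a ring) \<iota> \<rho>. splitting R r F \<iota> \<rho> \<and> \<iota> ?t = matrix_trace F r (\<rho> l))"
      using \<open>?t \<in> centre R\<close> splitting_rho by blast
    fix c assume "c \<in> centre R \<and> (\<exists>(F :: 'a ring) \<iota> \<rho>. splitting R r F \<iota> \<rho> \<and> \<iota> c = matrix_trace F r (\<rho> l))"
    then obtain F :: "'a ring" and \<iota> \<rho> where c: "c \<in> centre R" and s: "splitting R r F \<iota> \<rho>"
      and ic: "\<iota> c = matrix_trace F r (\<rho> l)" by blast
    interpret E: field F using s by (simp add: splitting_def)
    interpret C: field "R\<lparr>carrier := centre R\<rparr>" by (rule subfield_iff(2)[OF centre_subfield])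
    have \<iota>: "\<iota> \<in> ring_hom (R\<lparr>carrier := centre R\<rparr>) F" using s by (simp add: splitting_def)
    note h = ring_hom_memE[OF \<iota>, simplified]
    interpret h: ring_hom_ring "R\<lparr>carrier := centre R\<rparr>" F \<iota>
      by (intro ring_hom_ringI2 C.ring_axioms E.ring_axioms \<iota>)
    have pow: "\<iota> (add_pow R (k::nat) x) = add_pow F k (\<iota> x)" if x: "x \<in> centre R" for k x
    proof (induction k)
      case 0
      show ?case using h.hom_zero by simp
    next
      case (Suc k)
      then show ?case using h(3) add_pow_subfield[OF centre_subfield x, of k] x by simp
    qed
    \<comment> \<open>Injectivity of \<iota> on the field \<open>centre R\<close> brings the
      equation back from \<open>F\<close>; it is the equation that \<open>?t\<close>
      satisfies.\<close>
    have "\<iota> (add_pow R ?m c) = \<iota> (add_pow R r ?T)"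
      using pow[OF c] pow[OF T(1)] ic splitting_trace_orbit_sum[OF s l] by simp
    moreover have "inj_on \<iota> (centre R)"
      using h.img_is_subfield(1)[OF C.carrier_is_subfield] E.one_not_zero by simp
    ultimately have "add_pow R ?m c = add_pow R r ?T"
      using add_pow_subfield[OF centre_subfield] c T(1) by (auto dest: inj_onD)
    then show "c = ?t"
      using add_pow_cancel[of c ?t ?m] eq t c card_restricted_auts subfieldD(4)[OF centre_subfield] by simp
  qed
qed

lemma reduced_trace_closed: "l \<in> L \<Longrightarrow> reduced_trace R r l \<in> centre R"
  using reduced_trace_eq by simp

lemma reduced_trace_add:
  "\<lbrakk>l \<in> L; l' \<in> L\<rbrakk> \<Longrightarrow> reduced_trace R r (l \<oplus> l') = reduced_trace R r l \<oplus> reduced_trace R r l'"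
  using splitting_trace(2)[OF splitting_rho, of l l'] by (simp add: reduced_trace_eq(1) LD(4,6))

lemma reduced_trace_aut:
  assumes "\<phi> \<in> G" "l \<in> L"
  shows "reduced_trace R r (\<phi> l) = reduced_trace R r l"
proof -
  have "restrict \<phi> L \<in> restricted_auts" using assms(1) unfolding restricted_auts_def by blast
  from splitting_trace_aut[OF splitting_rho this assms(2)] show ?thesis
    using assms field_autsD(1)[OF assms] by (simp add: reduced_trace_eq(1))
qed

end

section \<open>Unitary involutions\<close>

locale skew_field_involution = skew_field + unitary_involution R \<tau> for \<tau>
begin

lemma tau_zero [simp]: "\<tau> \<zero> = \<zero>"
  using additive[of \<zero> \<zero>] closed[of \<zero>] by simp

lemma tau_minus: "x \<in> carrier R \<Longrightarrow> \<tau> (\<ominus> x) = \<ominus> \<tau> x"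
  using additive[of "\<ominus> x" x] closed by (simp add: l_neg minus_equality)

lemma tau_nonzero: "x \<in> carrier R \<Longrightarrow> x \<noteq> \<zero> \<Longrightarrow> \<tau> x \<noteq> \<zero>"
  using involutive[of x] by force

lemma tau_inv: "x \<in> carrier R \<Longrightarrow> x \<noteq> \<zero> \<Longrightarrow> \<tau> (inv x) = inv (\<tau> x)"
  using anti_mult[of x "inv x"] closed unital by (intro inv_unique_left) simp_all

lemma tau_centre:
  assumes "z \<in> centre R"
  shows "\<tau> z \<in> centre R"
proof -
  have z: "z \<in> carrier R" using assms by (simp add: centre_def)
  have "\<tau> z \<otimes> x = x \<otimes> \<tau> z" if x: "x \<in> carrier R" for x
    using arg_cong[OF centre_commute[OF assms closed[OF x]], of \<tau>] x z anti_mult closed involutive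
    by simp
  then show ?thesis using closed[OF z] unfolding centre_def by blast
qed

text \<open>Commutativity of \<open>K\<close> hides the reversal of products by \<tau>;
  \<open>K\<close> itself need not be stable under \<tau>.\<close>

lemma Sym_subfield:
  assumes "subfield K R"
  shows "subfield (K \<inter> Sym R \<tau>) R"
proof (rule subfieldI_commute)
  note C = subfieldD[OF assms]
  have c: "x \<in> K" "\<tau> x = x" "x \<in> carrier R" if "x \<in> K \<inter> Sym R \<tau>" for x
    using that by (auto simp: Sym_def)
  show "subring (K \<inter> Sym R \<tau>) R"
  proof (rule subringI)
    show "K \<inter> Sym R \<tau> \<subseteq> carrier R" using c(3) by blast
    show "\<one> \<in> K \<inter> Sym R \<tau>" using C(3) unital by (simp add: Sym_def)
    fix x assume x: "x \<in> K \<inter> Sym R \<tau>"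
    show "\<ominus> x \<in> K \<inter> Sym R \<tau>" using c[OF x] C(5) tau_minus by (simp add: Sym_def)
    fix y assume y: "y \<in> K \<inter> Sym R \<tau>"
    show "x \<oplus> y \<in> K \<inter> Sym R \<tau>" using c[OF x] c[OF y] C(6) additive by (simp add: Sym_def)
    show "x \<otimes> y \<in> K \<inter> Sym R \<tau>"
      using c[OF x] c[OF y] C(8) anti_mult[of x y] C(9)[of y x] by (simp add: Sym_def)
  qed
  show "x \<otimes> y = y \<otimes> x" if "x \<in> K \<inter> Sym R \<tau>" "y \<in> K \<inter> Sym R \<tau>" for x y
    using C(9) c(1) that by blast
  show "inv x \<in> K \<inter> Sym R \<tau>" if "x \<in> K \<inter> Sym R \<tau>" "x \<noteq> \<zero>" for x
    using c[OF that(1)] that(2) C(10) tau_inv by (simp add: Sym_def)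
qed

lemma fixed_centre_subfield: "subfield (fixed_centre R \<tau>) R"
proof -
  have "fixed_centre R \<tau> = centre R \<inter> Sym R \<tau>" by (auto simp: fixed_centre_def Sym_def centre_def)
  then show ?thesis using Sym_subfield[OF centre_subfield] by simp
qed

text \<open>The symmetric elements of the double centralizer of \<open>L\<^sub>0 \<union> {u}\<close> form a subfield containing \<open>u\<close>.\<close>

lemma symmetric_centralizer:
  assumes "maximal_symmetric_subfield R \<tau> L\<^sub>0"
    and u: "u \<in> carrier R" "\<tau> u = u" "\<And>l. l \<in> L\<^sub>0 \<Longrightarrow> l \<otimes> u = u \<otimes> l"
  shows "u \<in> L\<^sub>0"
proof -
  have L0: "subfield L\<^sub>0 R" "L\<^sub>0 \<subseteq> Sym R \<tau>"
    and max: "\<And>M. subfield M R \<Longrightarrow> L\<^sub>0 \<subseteq> M \<Longrightarrow> M \<subseteq> Sym R \<tau> \<Longrightarrow> M = L\<^sub>0"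
    using assms(1) unfolding maximal_symmetric_subfield_def by blast+
  note D = subfieldD[OF L0(1)]
  let ?X = "insert u L\<^sub>0"
  define C where "C = {z \<in> carrier R. \<forall>a\<in>?X. z \<otimes> a = a \<otimes> z}"
  define M where "M = {x \<in> carrier R. \<forall>z\<in>C. x \<otimes> z = z \<otimes> x}"
  have C: "z \<in> carrier R" if "z \<in> C" for z using that by (simp add: C_def)
  have M: "x \<in> carrier R" if "x \<in> M" for x using that by (simp add: M_def)
  have Mc: "x \<otimes> z = z \<otimes> x" if "x \<in> M" "z \<in> C" for x z using that unfolding M_def by blast
  have Xc: "a \<otimes> b = b \<otimes> a" if "a \<in> ?X" "b \<in> ?X" for a b
    using that u(3) D(9) by (metis insert_iff)
  have XC: "?X \<subseteq> C" using u(1) D(1) Xc unfolding C_def by blast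
  have XM: "?X \<subseteq> M" using u(1) D(1) unfolding M_def C_def by fastforce
  \<comment> \<open>What commutes with all of \<open>C\<close> commutes with \<open>?X\<close>,
    since \<open>?X\<close> lies in \<open>C\<close>. So \<open>M\<close> lies in its own
    centralizer and is commutative.\<close>
  have "M \<subseteq> C" using M Mc XC unfolding C_def by blast
  then have comm: "x \<otimes> y = y \<otimes> x" if "x \<in> M" "y \<in> M" for x y using Mc that by blast
  have "subfield M R"
  proof (rule subfieldI_commute)
    show "subring M R"
    proof (rule subringI)
      show "M \<subseteq> carrier R" using M by blast
      show "\<one> \<in> M" using C by (simp add: M_def)
      fix x assume x: "x \<in> M"
      show "\<ominus> x \<in> M" using M[OF x] Mc[OF x] C by (simp add: M_def l_minus r_minus)
      fix y assume y: "y \<in> M"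
      show "x \<oplus> y \<in> M" using M[OF x] Mc[OF x] M[OF y] Mc[OF y] C by (simp add: M_def l_distr r_distr)
      have "x \<otimes> y \<otimes> z = z \<otimes> (x \<otimes> y)" if z: "z \<in> C" for z
      proof -
        have "x \<otimes> y \<otimes> z = x \<otimes> z \<otimes> y" using M[OF x] M[OF y] C[OF z] Mc[OF y z] by (simp add: m_assoc)
        then show ?thesis using M[OF x] M[OF y] C[OF z] Mc[OF x z] by (simp add: m_assoc)
      qed
      then show "x \<otimes> y \<in> M" using M[OF x] M[OF y] by (simp add: M_def)
    qed
    show "inv x \<in> M" if x: "x \<in> M" "x \<noteq> \<zero>" for x
    proof -
      have "inv x \<otimes> z = z \<otimes> inv x" if z: "z \<in> C" for z
        using inv_commute[OF M[OF x(1)] x(2) C[OF z] Mc[OF x(1) z]] .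
      then show ?thesis using inv_simps(1)[OF M[OF x(1)] x(2)] by (simp add: M_def)
    qed
  qed (rule comm)
  then have "M \<inter> Sym R \<tau> = L\<^sub>0"
    using XM L0(2) by (intro max Sym_subfield) auto
  moreover have "u \<in> M \<inter> Sym R \<tau>" using XM u by (simp add: Sym_def)
  ultimately show ?thesis by blast
qed

end

section \<open>The field generated by the symmetric subfield and a square root of -d\<close>

text \<open>That \<open>L\<close> is a subfield containing the centre is read off from the
  hypothesis that it is Galois over the centre.\<close>

locale quadratic_centre = skew_field_involution +
  fixes d s :: 'a and L\<^sub>0 L :: "'a set"
  assumes two: "\<one> \<oplus> \<one> \<noteq> \<zero>"
    and d: "d \<in> fixed_centre R \<tau>" and s: "s \<in> centre R" and ss: "s \<otimes> s = \<ominus> d"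
    and centre_generated: "centre R = generate_field R (fixed_centre R \<tau> \<union> {s})"
    and L0_maximal: "maximal_symmetric_subfield R \<tau> L\<^sub>0"
    and L_generated: "L = generate_field R (L\<^sub>0 \<union> {s})"
    and L_subfield: "subfield L R" and centre_subset: "centre R \<subseteq> L"
begin

lemma s_carrier: "s \<in> carrier R"
  using s by (simp add: centre_def)

lemma L0_props: "subfield L\<^sub>0 R" "fixed_centre R \<tau> \<subseteq> L\<^sub>0" "l \<in> L\<^sub>0 \<Longrightarrow> l \<in> L"
    "l \<in> L\<^sub>0 \<Longrightarrow> l \<in> carrier R" "l \<in> L\<^sub>0 \<Longrightarrow> \<tau> l = l" "s \<in> L"
  using L0_maximal generate_field.incl[of _ "L\<^sub>0 \<union> {s}" R] unfolding L_generated
  by (auto simp: maximal_symmetric_subfield_def Sym_def)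

text \<open>Otherwise \<tau> would fix everything generated by \<open>s\<close> and the fixed field,
  which is the whole centre.\<close>

lemma s_not_fixed: "\<tau> s \<noteq> s"
proof
  assume fixed: "\<tau> s = s"
  have "z \<in> centre R \<and> \<tau> z = z" if "z \<in> generate_field R (fixed_centre R \<tau> \<union> {s})" for z
    using that
  proof (induction rule: generate_field.induct)
    case one
    then show ?case using unital subfieldD(3)[OF centre_subfield] by simp
  next
    case (incl h)
    then show ?case using fixed s by (auto simp: fixed_centre_def)
  next
    case (a_inv h)
    then show ?case using tau_minus subfieldD(4,5)[OF centre_subfield] by simp
  next
    case (m_inv h)
    then show ?case using tau_inv subfieldD(4,10)[OF centre_subfield] by simp
  next
    case (eng_add h1 h2)
    then show ?case using additive subfieldD(4,6)[OF centre_subfield] by simp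
  next
    case (eng_mult h1 h2)
    then show ?case
      using anti_mult[of h1 h2] subfieldD(4,8)[OF centre_subfield] subfieldD(9)[OF centre_subfield, of h2 h1]
      by simp
  qed
  then show False using nontrivial_on_centre unfolding centre_generated[symmetric] by blast
qed

text \<open>As \<open>d\<close> is symmetric, \<open>\<tau> s\<close> and \<open>s\<close> have the
  same square; they commute, so they agree up to sign.\<close>

lemma tau_s: "\<tau> s = \<ominus> s"
proof -
  have ts: "\<tau> s \<in> carrier R" using closed s_carrier .
  have comm: "s \<otimes> \<tau> s = \<tau> s \<otimes> s" using centre_commute[OF s ts] .
  have dc: "d \<in> carrier R" "\<tau> d = d" using d by (auto simp: fixed_centre_def centre_def)
  have tt: "\<tau> s \<otimes> \<tau> s = s \<otimes> s"
    using anti_mult[OF s_carrier s_carrier] ss tau_minus[OF dc(1)] dc(2) by simp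
  have "(\<tau> s \<ominus> s) \<otimes> (\<tau> s \<oplus> s) = \<zero>"
    using ts s_carrier tt comm
    by (simp add: a_minus_def l_distr r_distr l_minus a_ac r_neg r_neg2 r_neg1)
  then have "\<tau> s \<ominus> s = \<zero> \<or> \<tau> s \<oplus> s = \<zero>" using ts s_carrier by simp
  then consider "\<tau> s = s" | "\<tau> s \<oplus> s = \<zero>" using ts s_carrier r_right_minus_eq by blast
  then show ?thesis
  proof cases
    case 1
    then show ?thesis using s_not_fixed by simp
  next
    case 2
    then show ?thesis using ts s_carrier minus_equality by simp
  qed
qed

lemma s_nonzero: "s \<noteq> \<zero>"
  using s_not_fixed by force

lemmas LDs = subfieldD[OF L_subfield]

lemma tau_L:
  assumes "l \<in> L"
  shows "\<tau> l \<in> L"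
proof -
  have gen: "x \<in> L" if "x \<in> generate_field R (L\<^sub>0 \<union> {s})" for x using that L_generated by simp
  show ?thesis using assms unfolding L_generated
  proof (induction rule: generate_field.induct)
    case one
    then show ?case using unital generate_field.one by simp
  next
    case (incl h)
    then consider "h \<in> L\<^sub>0" | "h = s" by blast
    then show ?case
      using tau_s L0_props(5) incl generate_field.incl[of h "L\<^sub>0 \<union> {s}" R]
      by cases (simp_all add: generate_field.a_inv)
  next
    case (a_inv h)
    then show ?case using tau_minus gen LDs(4) by (simp add: generate_field.a_inv)
  next
    case (m_inv h)
    then show ?case using tau_inv tau_nonzero gen LDs(4) by (simp add: generate_field.m_inv)
  next
    case (eng_add h1 h2)
    then show ?case using additive gen LDs(4) by (simp add: generate_field.eng_add)
  next
    case (eng_mult h1 h2)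
    then show ?case using anti_mult gen LDs(4) by (simp add: generate_field.eng_mult)
  qed
qed

lemma half_in_L:
  assumes "x \<in> carrier R" "x \<oplus> x \<in> L"
  shows "x \<in> L"
proof -
  have t: "\<one> \<oplus> \<one> \<in> L" "\<one> \<oplus> \<one> \<in> carrier R" using LDs(3,6) by auto
  have "inv (\<one> \<oplus> \<one>) \<otimes> (x \<oplus> x) = inv (\<one> \<oplus> \<one>) \<otimes> ((\<one> \<oplus> \<one>) \<otimes> x)"
    using assms(1) by (simp add: l_distr)
  also have "\<dots> = x" using t(2) two assms(1) by (intro inv_cancel)
  finally show ?thesis using LDs(8)[OF LDs(10)[OF t(1) two] assms(2)] by simp
qed

text \<open>The element \<open>x \<oplus> \<tau> x\<close> is symmetric, and so is
  \<open>inv s\<close> times the skew element \<open>x \<ominus> \<tau> x\<close>, because \<tau>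
  negates the central \<open>s\<close>. Both commute with \<open>L\<^sub>0\<close>, so maximality
  puts them in \<open>L\<^sub>0\<close>; then twice \<open>x\<close> lies in \<open>L\<close>, and 2
  is invertible.\<close>

lemma L_self_centralizing:
  assumes x: "x \<in> carrier R" and comm: "\<And>l. l \<in> L \<Longrightarrow> l \<otimes> x = x \<otimes> l"
  shows "x \<in> L"
proof -
  have tx: "\<tau> x \<in> carrier R" using closed[OF x] .
  have tcomm: "l \<otimes> \<tau> x = \<tau> x \<otimes> l" if l: "l \<in> L" for l
  proof -
    have lc: "l \<in> carrier R" "\<tau> l \<in> carrier R" using LDs(4)[OF l] closed by auto
    from arg_cong[OF comm[OF tau_L[OF l]], of \<tau>] show ?thesis
      using anti_mult lc x involutive by simp
  qed
  define w where "w = x \<ominus> \<tau> x"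
  define v where "v = inv s \<otimes> w"
  have w: "w \<in> carrier R" using x tx by (simp add: w_def)
  have is_c: "inv s \<in> centre R" using subfieldD(10)[OF centre_subfield s s_nonzero] .
  have is_r: "inv s \<in> carrier R" using inv_simps(1)[OF s_carrier s_nonzero] .
  have v: "v \<in> carrier R" using w is_r by (simp add: v_def)
  have "x \<oplus> \<tau> x \<in> L\<^sub>0"
  proof (rule symmetric_centralizer[OF L0_maximal])
    show "\<tau> (x \<oplus> \<tau> x) = x \<oplus> \<tau> x" using x tx additive involutive by (simp add: a_comm)
    fix l assume "l \<in> L\<^sub>0"
    then have "l \<in> L" "l \<in> carrier R" using L0_props(3,4) by auto
    then show "l \<otimes> (x \<oplus> \<tau> x) = (x \<oplus> \<tau> x) \<otimes> l"
      using x tx comm[OF \<open>l \<in> L\<close>] tcomm[OF \<open>l \<in> L\<close>] by (simp add: l_distr r_distr)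
  qed (use x tx in simp)
  moreover have "v \<in> L\<^sub>0"
  proof (rule symmetric_centralizer[OF L0_maximal v])
    have "\<tau> w = \<ominus> w"
      using x tx additive involutive tau_minus by (simp add: w_def a_minus_def minus_add a_comm)
    moreover have "\<tau> (inv s) = \<ominus> (inv s)"
    proof -
      have "\<ominus> (inv s) = inv (\<ominus> s)"
        using s_carrier s_nonzero is_r by (intro inv_unique_left) (simp_all add: l_minus r_minus)
      then show ?thesis using tau_inv[OF s_carrier s_nonzero] tau_s by simp
    qed
    ultimately have "\<tau> v = w \<otimes> inv s"
      using anti_mult[OF is_r w] w is_r by (simp add: v_def l_minus r_minus)
    then show "\<tau> v = v" using centre_commute[OF is_c w] by (simp add: v_def)
    fix l assume "l \<in> L\<^sub>0"
    then have l: "l \<in> L" "l \<in> carrier R" using L0_props(3,4) by auto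
    have lw: "l \<otimes> w = w \<otimes> l"
      using x tx l comm[OF l(1)] tcomm[OF l(1)] by (simp add: w_def a_minus_def l_distr r_distr l_minus r_minus)
    have "l \<otimes> v = (l \<otimes> inv s) \<otimes> w" using l is_r w by (simp add: v_def m_assoc)
    also have "\<dots> = inv s \<otimes> (l \<otimes> w)"
      using centre_commute[OF is_c l(2)] l is_r w by (simp flip: m_assoc)
    also have "\<dots> = v \<otimes> l" using lw l is_r w by (simp add: v_def m_assoc)
    finally show "l \<otimes> v = v \<otimes> l" .
  qed
  ultimately have "(x \<oplus> \<tau> x) \<oplus> s \<otimes> v \<in> L" using LDs(6,8) L0_props(3,6) by simp
  moreover have "s \<otimes> v = w" using inv_cancel(2)[OF s_carrier s_nonzero w] by (simp add: v_def)
  moreover have "(x \<oplus> \<tau> x) \<oplus> w = x \<oplus> x"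
    using x tx by (simp add: w_def a_minus_def a_ac r_neg r_neg2)
  ultimately show ?thesis using half_in_L[OF x] by simp
qed

text \<open>By maximality again. It recovers \<open>L\<^sub>0\<close> from \<open>L\<close>, so an
  automorphism of \<open>L\<close> preserves \<open>L\<^sub>0\<close> once it commutes with
  \<tau>.\<close>

lemma L_Sym: "L \<inter> Sym R \<tau> = L\<^sub>0"
  using L0_maximal Sym_subfield[OF L_subfield] L0_props(3)
  unfolding maximal_symmetric_subfield_def by blast

end

section \<open>Positive involutions\<close>

lemma field_auts_inverse:
  assumes "ring (R\<lparr>carrier := L\<rparr>)" "\<phi> \<in> field_auts R K L" "K \<subseteq> L"
  shows "inv_into L \<phi> \<in> field_auts R K L"
proof -
  have "inv_into L \<phi> \<in> ring_iso (R\<lparr>carrier := L\<rparr>) (R\<lparr>carrier := L\<rparr>)"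
    using ring_iso_set_sym[OF assms(1), of \<phi> "R\<lparr>carrier := L\<rparr>"] assms(2)
    by (simp add: field_auts_def)
  moreover have "inv_into L \<phi> x = x" if "x \<in> K" for x
    using field_autsD(5,6)[OF assms(2)] that assms(3)
    by (intro inv_into_f_eq) (auto simp: bij_betw_def)
  ultimately show ?thesis by (simp add: field_auts_def)
qed

context ring
begin

text \<open>A zero sum would put both \<open>x\<close> and its negative in \<open>P\<close>.\<close>

lemma field_ordering_sum:
  assumes "field_ordering R K P" "K \<subseteq> carrier R" "x \<in> P - {\<zero>}" "y \<in> P - {\<zero>}"
  shows "x \<oplus> y \<in> P - {\<zero>}"
proof -
  have P: "P \<subseteq> K" "x \<oplus> y \<in> P" "\<And>z. z \<in> P \<Longrightarrow> \<ominus> z \<in> P \<Longrightarrow> z = \<zero>"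
    using assms unfolding field_ordering_def by blast+
  have c: "x \<in> carrier R" "y \<in> carrier R" using P(1) assms(2-4) by auto
  have "x \<oplus> y \<noteq> \<zero>"
  proof
    assume "x \<oplus> y = \<zero>"
    then have "\<ominus> x = y" using c by (simp add: a_comm minus_equality)
    then show False using P(3)[of x] assms(3,4) by simp
  qed
  then show ?thesis using P(2) by simp
qed

text \<open>If -1 lies in \<open>P\<close>, so does its square 1. Hence 1 is strictly positive in
  any case, and so are its positive multiples.\<close>

lemma field_ordering_char_zero:
  assumes "field_ordering R K P" "K \<subseteq> carrier R" "\<one> \<in> K" "\<one> \<noteq> \<zero>" "0 < m"
  shows "add_pow R (m::nat) \<one> \<noteq> \<zero>"
proof -
  have "\<ominus> \<one> \<in> P \<Longrightarrow> \<ominus> \<one> \<otimes> \<ominus> \<one> \<in> P" "\<one> \<in> P \<or> \<ominus> \<one> \<in> P"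
    using assms(1,3) unfolding field_ordering_def by blast+
  then have one: "\<one> \<in> P - {\<zero>}" using assms(4) by (auto simp: l_minus)
  have "add_pow R (Suc k) \<one> \<in> P - {\<zero>}" for k
  proof (induction k)
    case 0
    then show ?case using one by simp
  next
    case (Suc k)
    then show ?case using field_ordering_sum[OF assms(1,2) Suc one] by simp
  qed
  from this[of "m - 1"] show ?thesis using assms(5) by simp
qed

end

locale positive_galois_subfield = galois_self_centralizing_subfield + skew_field_involution +
  fixes P :: "'a set"
  assumes tau_L: "l \<in> L \<Longrightarrow> \<tau> l \<in> L"
    and ordering: "field_ordering R (fixed_centre R \<tau>) P"
    and positive: "x \<in> carrier R \<Longrightarrow> x \<noteq> \<zero> \<Longrightarrow> reduced_trace R r (\<tau> x \<otimes> x) \<in> P - {\<zero>}"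
begin

abbreviation "tr \<equiv> reduced_trace R r"

text \<open>The two reversals cancel, and a central \<open>x\<close> is fixed because \<phi> fixes
  the central element \<open>\<tau> x\<close>.\<close>

lemma tau_conjugate:
  assumes "\<phi> \<in> G"
  shows "(\<lambda>x. \<tau> (\<phi> (\<tau> x))) \<in> G"
proof -
  note \<phi> = field_autsD[OF assms]
  show ?thesis
  proof (rule field_autsI)
    fix x assume x: "x \<in> L"
    show "\<tau> (\<phi> (\<tau> x)) \<in> L" using \<phi>(1) tau_L x by blast
    fix y assume y: "y \<in> L"
    have c: "\<tau> x \<in> L" "\<tau> y \<in> L" "x \<in> carrier R" "y \<in> carrier R"
      "\<phi> (\<tau> x) \<in> carrier R" "\<phi> (\<tau> y) \<in> carrier R"
      using x y tau_L \<phi>(1) LD(4) by blast+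
    show "\<tau> (\<phi> (\<tau> (x \<oplus> y))) = \<tau> (\<phi> (\<tau> x)) \<oplus> \<tau> (\<phi> (\<tau> y))"
      using c by (simp add: additive \<phi>(2))
    show "\<tau> (\<phi> (\<tau> (x \<otimes> y))) = \<tau> (\<phi> (\<tau> x)) \<otimes> \<tau> (\<phi> (\<tau> y))"
      using c by (simp add: anti_mult \<phi>(3))
  next
    show "\<tau> (\<phi> (\<tau> \<one>)) = \<one>" by (simp add: unital \<phi>(4))
    show "\<tau> (\<phi> (\<tau> x)) = x" if "x \<in> centre R" for x
      using \<phi>(5)[OF tau_centre[OF that]] involutive subfieldD(4)[OF centre_subfield that] by simp
    have "bij_betw \<tau> L L"
      by (rule bij_betw_byWitness[of _ \<tau>]) (use tau_L involutive LD(4) in auto)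
    from bij_betw_trans[OF this bij_betw_trans[OF \<phi>(6) this]]
    show "bij_betw (\<lambda>x. \<tau> (\<phi> (\<tau> x))) L L" by (simp add: comp_def)
  qed
qed

text \<open>Two positive involutions \<open>\<tau>\<close> and \<open>\<phi>\<inverse> \<tau> \<phi>\<close> of \<open>L\<close> with the same restriction to the centre
  coincide: their quotient \<open>\<psi>\<close> is self-adjoint and positive, with all its powers, for the form
  \<open>tr (\<tau> x y)\<close>, and has finite order.\<close>

lemma aut_commutes_tau:
  assumes "\<phi> \<in> G" "x \<in> L"
  shows "\<phi> (\<tau> x) = \<tau> (\<phi> x)"
proof -
  define \<phi>' where "\<phi>' = inv_into L \<phi>"
  \<comment> \<open>Composed of \<open>\<tau> \<phi>' \<tau>\<close> and \<phi>, it fixes the centre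
    although \<tau> does not.\<close>
  define \<psi> where "\<psi> = (\<lambda>x. \<tau> (\<phi>' (\<tau> (\<phi> x))))"
  have "ring (R\<lparr>carrier := L\<rparr>)"
    using subfield_iff(2)[OF L_subfield] field.is_ring by blast
  then have \<phi>'G: "\<phi>' \<in> G"
    unfolding \<phi>'_def using field_auts_inverse assms(1) centre_subset by blast
  have \<psi>G: "\<psi> \<in> G"
    unfolding \<psi>_def by (rule field_auts_comp[OF tau_conjugate[OF \<phi>'G] assms(1) centre_subset])
  note \<phi> = field_autsD[OF assms(1)] and \<phi>' = field_autsD[OF \<phi>'G] and \<psi> = field_autsD[OF \<psi>G]
  have inv1: "\<phi>' (\<phi> y) = y" and inv2: "\<phi> (\<phi>' y) = y" if "y \<in> L" for y
    using that \<phi>(6) unfolding \<phi>'_def by (simp_all add: bij_betw_inv_into_left bij_betw_inv_into_right)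
  have tt: "\<tau> (\<tau> y) = y" if "y \<in> L" for y using involutive LD(4) that by blast
  have tau_psi: "\<tau> (\<psi> y) = \<phi>' (\<tau> (\<phi> y))" if "y \<in> L" for y
    using tt \<phi>(1) \<phi>'(1) tau_L that by (simp add: \<psi>_def)
  \<comment> \<open>Together with invariance of \<open>tr\<close> under \<psi> this is
    self-adjointness: \<open>tr (\<tau> (\<psi> y) \<otimes> z) = tr (\<tau> y \<otimes> \<psi>
    z)\<close>.\<close>
  have key: "\<psi> (\<tau> (\<psi> y)) = \<tau> y" if y: "y \<in> L" for y
  proof -
    have "\<psi> (\<tau> (\<psi> y)) = \<tau> (\<phi>' (\<tau> (\<phi> (\<phi>' (\<tau> (\<phi> y))))))"
      unfolding tau_psi[OF y] by (simp add: \<psi>_def)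
    also have "\<dots> = \<tau> (\<phi>' (\<tau> (\<tau> (\<phi> y))))" using inv2[OF tau_L[OF \<phi>(1)[OF y]]] by simp
    also have "\<dots> = \<tau> y" using tt[OF \<phi>(1)[OF y]] inv1[OF y] by simp
    finally show ?thesis .
  qed
  have pow_G: "(\<psi> ^^ j) \<in> G" for j
  proof (induction j)
    case 0
    then show ?case using id_aut by (simp add: id_def)
  next
    case (Suc j)
    then show ?case using field_auts_comp[OF \<psi>G Suc centre_subset] by (simp add: comp_def)
  qed
  have pow_L: "(\<psi> ^^ j) y \<in> L" if "y \<in> L" for j y
    using field_autsD(1)[OF pow_G] that .
  have inj: "y = z" if "(\<psi> ^^ j) y = (\<psi> ^^ j) z" "y \<in> L" "z \<in> L" for j y z
    using field_autsD(6)[OF pow_G[of j]] that unfolding bij_betw_def inj_on_def by blast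
  have psi_zero: "y = \<zero>" if "\<psi> y = \<zero>" "y \<in> L" for y
    using inj[of 1 y \<zero>] that \<psi>(5) subfieldD(2)[OF centre_subfield] LD(2) by simp
  have pos: "tr (\<tau> y \<otimes> y) \<in> P - {\<zero>}" if "y \<in> L" "y \<noteq> \<zero>" for y
    using positive[OF LD(4)[OF that(1)] that(2)] .
  \<comment> \<open>Induction in steps of two: by self-adjointness the value for
    \<open>j + 2\<close> at \<open>y\<close> is the value for \<open>j\<close> at
    \<open>\<psi> y\<close>. For 0 it is positivity at \<open>y\<close>, and for 1 invariance under
    \<phi> turns it into positivity at \<open>\<phi> y\<close>.\<close>
  have pow_pos: "tr (\<tau> y \<otimes> (\<psi> ^^ j) y) \<in> P - {\<zero>}" if "y \<in> L" "y \<noteq> \<zero>" for j y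
    using that
  proof (induction j arbitrary: y rule: induct_nat_012)
    case 0
    then show ?case using pos by simp
  next
    case 1
    have w: "\<tau> (\<psi> y) \<in> L" using tau_L \<psi>(1) 1 by blast
    have "tr (\<tau> y \<otimes> \<psi> y) = tr (\<psi> (\<tau> (\<psi> y) \<otimes> y))"
      using \<psi>(3)[OF w 1(1)] key[OF 1(1)] by simp
    also have "\<dots> = tr (\<tau> (\<psi> y) \<otimes> y)"
      by (rule reduced_trace_aut[OF \<psi>G LD(8)[OF w 1(1)]])
    also have "\<dots> = tr (\<phi> (\<tau> (\<psi> y) \<otimes> y))"
      by (rule reduced_trace_aut[OF assms(1) LD(8)[OF w 1(1)], symmetric])
    also have "\<phi> (\<tau> (\<psi> y) \<otimes> y) = \<tau> (\<phi> y) \<otimes> \<phi> y"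
      using \<phi>(3)[OF w 1(1)] tau_psi[OF 1(1)] inv2[OF tau_L[OF \<phi>(1)[OF 1(1)]]] by simp
    finally have eq: "tr (\<tau> y \<otimes> \<psi> y) = tr (\<tau> (\<phi> y) \<otimes> \<phi> y)" .
    have "\<phi> y \<noteq> \<zero>"
    proof
      assume "\<phi> y = \<zero>"
      then have "y = \<phi>' \<zero>" using inv1[OF 1(1)] by simp
      then show False using \<phi>'(5)[OF subfieldD(2)[OF centre_subfield]] 1(2) by simp
    qed
    then show ?case using eq pos[OF \<phi>(1)[OF 1(1)]] by simp
  next
    case (ge2 j)
    have w: "\<psi> y \<in> L" "\<psi> y \<noteq> \<zero>" "\<tau> (\<psi> y) \<in> L" "(\<psi> ^^ j) (\<psi> y) \<in> L"
      using \<psi>(1) psi_zero pow_L tau_L ge2.prems by blast+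
    have "(\<psi> ^^ Suc (Suc j)) y = \<psi> ((\<psi> ^^ j) (\<psi> y))"
      by (simp add: funpow_swap1)
    then have "\<tau> y \<otimes> (\<psi> ^^ Suc (Suc j)) y = \<psi> (\<tau> (\<psi> y) \<otimes> (\<psi> ^^ j) (\<psi> y))"
      using \<psi>(3)[OF w(3,4)] key[OF ge2.prems(1)] by simp
    then have "tr (\<tau> y \<otimes> (\<psi> ^^ Suc (Suc j)) y) = tr (\<tau> (\<psi> y) \<otimes> (\<psi> ^^ j) (\<psi> y))"
      using reduced_trace_aut[OF \<psi>G LD(8)[OF w(3,4)]] by simp
    then show ?case using ge2.IH(1)[OF w(1,2)] by simp
  qed
  \<comment> \<open>Two powers of \<psi> agree on \<open>L\<close>, as their restrictions lie in a
    finite set; the smaller power is injective and cancels.\<close>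
  obtain m where m: "0 < m" "\<And>y. y \<in> L \<Longrightarrow> (\<psi> ^^ m) y = y"
  proof -
    have "range (\<lambda>j. restrict (\<psi> ^^ j) L) \<subseteq> restricted_auts"
      unfolding restricted_auts_def using pow_G by blast
    then have "finite (range (\<lambda>j. restrict (\<psi> ^^ j) L))"
      using finite_restricted_auts finite_subset by blast
    then have "\<not> inj (\<lambda>j. restrict (\<psi> ^^ j) L)"
      using finite_imageD infinite_UNIV_nat by blast
    then obtain i j where "i \<noteq> j" "restrict (\<psi> ^^ i) L = restrict (\<psi> ^^ j) L"
      unfolding inj_def by blast
    then obtain i j where ij: "i < j" "restrict (\<psi> ^^ i) L = restrict (\<psi> ^^ j) L"
      by (metis nat_neq_iff)
    have "(\<psi> ^^ (j - i)) y = y" if y: "y \<in> L" for y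
    proof (rule inj[of i])
      have "(\<psi> ^^ i) ((\<psi> ^^ (j - i)) y) = (\<psi> ^^ j) y"
        using ij(1) funpow_add[of i "j - i" \<psi>] by simp
      then show "(\<psi> ^^ i) ((\<psi> ^^ (j - i)) y) = (\<psi> ^^ i) y"
        using fun_cong[OF ij(2), of y] y by simp
    qed (use pow_L y in auto)
    then show ?thesis using that[of "j - i"] ij(1) by simp
  qed
  define y where "y = x \<ominus> \<psi> x"
  have xL: "x \<in> carrier R" "\<psi> x \<in> L" "\<psi> x \<in> carrier R" using assms(2) \<psi>(1) LD(4) by auto
  have yL: "y \<in> L" unfolding y_def using LD(7)[OF assms(2) xL(2)] .
  have "y = \<zero>"
  proof (rule ccontr)
    assume y0: "y \<noteq> \<zero>"
    have ty: "\<tau> y \<in> L" "\<tau> y \<in> carrier R" using tau_L[OF yL] LD(4) by auto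
    \<comment> \<open>Telescoping: \<open>x\<close> minus its image under the power
      \<open>k + 1\<close> is the sum of the images of \<open>y\<close> under the powers 0 to
      \<open>k\<close>. The exponent \<open>Suc k\<close> excludes the empty sum, which would not be
      strictly positive.\<close>
    have "tr (\<tau> y \<otimes> (x \<ominus> (\<psi> ^^ Suc k) x)) \<in> P - {\<zero>}" for k
    proof (induction k)
      case 0
      then show ?case using pos[OF yL y0] by (simp add: y_def)
    next
      case (Suc k)
      let ?f = "\<psi> ^^ Suc k"
      note f = field_autsD[OF pow_G[of "Suc k"]]
      have c: "?f x \<in> L" "?f (\<psi> x) \<in> L" "?f x \<in> carrier R" "?f (\<psi> x) \<in> carrier R" "?f y \<in> L"
        using f(1) assms(2) xL yL LD(4) by blast+
      have "?f y \<oplus> ?f (\<psi> x) = ?f (y \<oplus> \<psi> x)" using f(2)[OF yL xL(2)] by simp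
      also have "y \<oplus> \<psi> x = x" using xL by (simp add: y_def a_minus_def a_assoc l_neg)
      finally have fy: "?f y \<oplus> ?f (\<psi> x) = ?f x" .
      have "(\<psi> ^^ Suc (Suc k)) x = ?f (\<psi> x)" by (simp add: funpow_swap1)
      then have "x \<ominus> (\<psi> ^^ Suc (Suc k)) x = (x \<ominus> ?f x) \<oplus> ?f y"
        using c LD(4)[OF c(5)] xL fy[symmetric]
        by (simp only:) (simp add: a_minus_def minus_add a_ac r_neg r_neg2 del: funpow.simps)
      then have "tr (\<tau> y \<otimes> (x \<ominus> (\<psi> ^^ Suc (Suc k)) x))
          = tr (\<tau> y \<otimes> (x \<ominus> ?f x)) \<oplus> tr (\<tau> y \<otimes> ?f y)"
        using ty c xL assms(2) LD(4)[OF c(5)] reduced_trace_add[OF LD(8)[OF ty(1) LD(7)[OF assms(2) c(1)]] LD(8)[OF ty(1) c(5)]]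
        by (simp add: r_distr del: funpow.simps)
      then show ?case
        using field_ordering_sum[OF ordering _ Suc pow_pos[OF yL y0, of "Suc k"]]
          subfieldD(1)[OF fixed_centre_subfield] by (simp del: funpow.simps)
    qed
    \<comment> \<open>At exponent \<open>m\<close> the difference is zero, and
      \<open>tr \<zero> = \<zero>\<close> is not strictly positive.\<close>
    from this[of "m - 1"] have "tr (\<tau> y \<otimes> (x \<ominus> x)) \<in> P - {\<zero>}"
      using m(1) m(2)[OF assms(2)] by (simp del: funpow.simps)
    moreover have "tr \<zero> \<oplus> tr \<zero> = tr \<zero>" using reduced_trace_add[OF LD(2) LD(2)] by simp
    moreover have "tr \<zero> \<in> carrier R"
      using reduced_trace_closed[OF LD(2)] subfieldD(4)[OF centre_subfield] by blast
    ultimately show False using ty xL by (simp add: a_minus_def r_neg)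
  qed
  then have "\<psi> x = x" using xL by (simp add: y_def r_right_minus_eq)
  then have "\<phi>' (\<tau> (\<phi> x)) = \<tau> x" using tau_psi[OF assms(2)] by simp
  then show ?thesis using inv2[OF tau_L[OF \<phi>(1)[OF assms(2)]]] by simp
qed

end

section \<open>Algebraicity over the fixed field\<close>

context quadratic_centre
begin

text \<open>From a monic relation over the centre one gets a relation over the fixed field by adding the
  conjugate relation; the new leading coefficient is \<open>2\<close>.\<close>

lemma algebraic_over_fixed_centre:
  assumes x: "x \<in> L\<^sub>0" and alg: "(algebraic over centre R) x"
  shows "(algebraic over fixed_centre R \<tau>) x"
proof -
  interpret E: field "R\<lparr>carrier := L\<rparr>" by (rule subfield_iff(2)[OF L_subfield])
  have Lr: "subring L R" using subfieldE(1)[OF L_subfield] .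
  \<comment> \<open>\<open>R\<close> need not be commutative, so polynomials are handled inside the
    field \<open>L\<close>, where \<open>algebraic\<close> and \<open>eval\<close> have the same
    meaning.\<close>
  have cons: "algebraic = E.algebraic" by (rule algebraic_consistent[OF Lr])
  have xL: "x \<in> L" "x \<in> carrier R" "\<tau> x = x" using L0_props(3,4,5) x by auto
  note C = subfieldD[OF centre_subfield]
  have K: "subring (centre R) (R\<lparr>carrier := L\<rparr>)"
    using ring.subring_iff[OF E.ring_axioms, of "centre R"] subring_iff[of "centre R"]
      subfieldE(1)[OF centre_subfield] C(1) centre_subset by simp
  have "(E.algebraic over centre R) x" using alg cons by simp
  then obtain p where p: "p \<in> carrier (centre R [X]\<^bsub>R\<lparr>carrier := L\<rparr>\<^esub>)" "p \<noteq> []" "E.eval p x = \<zero>"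
    using E.algebraicE[OF K] xL(1) by auto
  have pc: "set p \<subseteq> centre R" "hd p \<noteq> \<zero>"
    using p(1,2) by (auto simp: univ_poly_def polynomial_def)
  have ev: "E.eval = eval" by (rule eval_consistent[OF Lr])
  \<comment> \<open>Normalizing comes first: \<tau> might negate the original leading coefficient,
    which would then cancel against its conjugate.\<close>
  define c where "c = inv (hd p)"
  have hd_p: "hd p \<in> centre R" "hd p \<in> carrier R"
    using subsetD[OF pc(1) hd_in_set[OF p(2)]] C(4) by auto
  have c: "c \<in> centre R" "c \<in> carrier R" "c \<otimes> hd p = \<one>"
    using C(10)[OF hd_p(1) pc(2)] C(4) inv_simps[OF hd_p(2) pc(2)] by (auto simp: c_def)
  define g where "g a = c \<otimes> a \<oplus> \<tau> (c \<otimes> a)" for a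
  have g: "g a \<in> fixed_centre R \<tau>" if "a \<in> centre R" for a
  proof -
    have ca: "c \<otimes> a \<in> centre R" "c \<otimes> a \<in> carrier R" using C(8)[OF c(1) that] C(4) by auto
    then show ?thesis
      using C(6)[OF ca(1) tau_centre[OF ca(1)]] additive closed involutive
      by (simp add: g_def fixed_centre_def a_comm)
  qed
  have eval_closed: "eval q x \<in> carrier R" if "set q \<subseteq> centre R" for q
    using eval_in_carrier[OF subset_trans[OF that C(1)] xL(2)] .
  have xpow: "x [^] k \<in> carrier R" "\<tau> (x [^] k) = x [^] k" for k :: nat
  proof -
    show "x [^] k \<in> carrier R" for k :: nat using xL(2) by simp
    then show "\<tau> (x [^] k) = x [^] k"
    proof (induction k)
      case (Suc k)
      then show ?case using xL anti_mult nat_pow_Suc2[OF xL(2), of k] by simp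
    qed (simp add: unital)
  qed
  have eval_g: "eval (map g q) x = c \<otimes> eval q x \<oplus> \<tau> (c \<otimes> eval q x)" if "set q \<subseteq> centre R" for q
    using that
  proof (induction q)
    case Nil
    then show ?case using c(2) by simp
  next
    case (Cons a q)
    let ?X = "x [^] length q"
    have a: "a \<in> centre R" "a \<in> carrier R" and q: "set q \<subseteq> centre R" using Cons.prems C(4) by auto
    have e: "eval q x \<in> carrier R" using eval_closed[OF q] .
    have ca: "c \<otimes> a \<in> carrier R" "\<tau> (c \<otimes> a) \<in> centre R" "\<tau> (c \<otimes> a) \<in> carrier R"
      using c a C(4) tau_centre[OF C(8)[OF c(1) a(1)]] by auto
    have ce: "c \<otimes> eval q x \<in> carrier R" "\<tau> (c \<otimes> eval q x) \<in> carrier R" using c e closed by auto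
    have "\<tau> (c \<otimes> a \<otimes> ?X) = \<tau> (c \<otimes> a) \<otimes> ?X"
      using anti_mult[OF ca(1) xpow(1)] xpow(2) centre_commute[OF ca(2) xpow(1)] by simp
    moreover have "c \<otimes> eval (a # q) x = c \<otimes> a \<otimes> ?X \<oplus> c \<otimes> eval q x"
      using c a e xpow by (simp add: r_distr m_assoc)
    ultimately have rhs: "c \<otimes> eval (a # q) x \<oplus> \<tau> (c \<otimes> eval (a # q) x)
        = (c \<otimes> a \<otimes> ?X \<oplus> c \<otimes> eval q x) \<oplus> (\<tau> (c \<otimes> a) \<otimes> ?X \<oplus> \<tau> (c \<otimes> eval q x))"
      using additive[of "c \<otimes> a \<otimes> ?X" "c \<otimes> eval q x"] ca(1) ce(1) xpow(1) by simp
    have "eval (map g (a # q)) x = g a \<otimes> ?X \<oplus> (c \<otimes> eval q x \<oplus> \<tau> (c \<otimes> eval q x))"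
      using Cons.IH[OF q] by simp
    also have "g a \<otimes> ?X = c \<otimes> a \<otimes> ?X \<oplus> \<tau> (c \<otimes> a) \<otimes> ?X"
      unfolding g_def using l_distr[OF ca(1,3) xpow(1)] .
    finally show ?case
      unfolding rhs using ca ce xpow(1) m_closed[OF ca(1) xpow(1)] m_closed[OF ca(3) xpow(1)]
      by (simp only: a_ac a_closed)
  qed
  have "eval (map g p) x = \<zero>"
    using eval_g[OF pc(1)] p(3) ev c(2) by simp
  moreover have "g (hd p) = \<one> \<oplus> \<one>" using c(3) unital by (simp add: g_def)
  then have "map g p \<in> carrier (fixed_centre R \<tau> [X]\<^bsub>R\<lparr>carrier := L\<rparr>\<^esub>)"
    using g pc(1) two p(2) by (auto simp: univ_poly_def polynomial_def hd_map)
  ultimately have "(E.algebraic over fixed_centre R \<tau>) x"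
    using E.algebraicI[of "map g p" "fixed_centre R \<tau>" x] p(2) ev by simp
  then show ?thesis using cons by simp
qed

end

section \<open>Descent of the Galois property to the symmetric subfield\<close>

theorem proposition2p3:
  fixes B :: "('a, 'm) ring_scheme" (structure)
    and n :: nat and \<tau> :: "'a \<Rightarrow> 'a" and d s :: 'a and k k\<^sub>0 L\<^sub>0 :: "'a set"
  assumes "central_division_algebra B n"
    and "unitary_involution B \<tau>"
    and "k = centre B" and "k\<^sub>0 = fixed_centre B \<tau>"
    and "\<one> \<oplus> \<one> \<noteq> \<zero>"
    and "d \<in> k\<^sub>0" and "s \<in> k" and "s \<otimes> s = \<ominus> d" and "k = generate_field B (k\<^sub>0 \<union> {s})"
    and "maximal_symmetric_subfield B \<tau> L\<^sub>0"
    and "galois_extension B k (generate_field B (L\<^sub>0 \<union> {s}))"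
    and "\<exists>P. field_ordering B k\<^sub>0 P \<and> positive_involution B n \<tau> P"
  shows "galois_extension B k\<^sub>0 L\<^sub>0"
proof -
  define L where "L = generate_field B (L\<^sub>0 \<union> {s})"
  interpret central_division_algebra B n by fact
  have galL: "galois_extension B (centre B) L" using assms(3,11) by (simp add: L_def)
  then have L: "subfield L B" "centre B \<subseteq> L"
    and alg: "\<And>x. x \<in> L \<Longrightarrow> (algebraic over centre B) x"
    unfolding galois_extension_def by blast+
  interpret skew_field B by unfold_locales (rule one_not_zero division)+
  interpret skew_field_involution B \<tau>
    by (intro skew_field_involution.intro skew_field_axioms assms(2))
  have q: "d \<in> fixed_centre B \<tau>" "s \<in> centre B"
    "centre B = generate_field B (fixed_centre B \<tau> \<union> {s})"
    using assms(6,7,9) unfolding assms(3,4) .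
  interpret quadratic_centre B \<tau> d s L\<^sub>0 L
    by (intro quadratic_centre.intro skew_field_involution_axioms quadratic_centre_axioms.intro
        assms(5,8,10) q L_def L)
  obtain bs where bs: "set bs \<subseteq> carrier B" "independent (centre B) bs" "length bs = n\<^sup>2"
      "Span (centre B) bs = carrier B"
    using exists_base[OF centre_subfield dimension_centre] by blast
  \<comment> \<open>\<open>bs\<close> spans already over the smaller field \<open>centre B\<close>,
    so an \<open>L\<close>-basis can be extracted from it.\<close>
  obtain us where us: "set us \<subseteq> carrier B" "independent L us" "Span L us = Span L bs"
    using filter_base[OF L(1) bs(1)] .
  have "carrier B \<subseteq> Span L bs"
  proof
    fix x assume "x \<in> carrier B"
    then obtain ks where "set ks \<subseteq> centre B" "x = combine ks bs"
      using Span_eq_combine_set[OF centre_subfield bs(1)] bs(4) by blast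
    then show "x \<in> Span L bs" using Span_eq_combine_set[OF L(1) bs(1)] L(2) by blast
  qed
  then have us_Span: "Span L us = carrier B"
    using us(3) Span_in_carrier[OF subfieldD(1)[OF L(1)] bs(1)] by blast
  obtain P where P: "field_ordering B (fixed_centre B \<tau>) P" "positive_involution B n \<tau> P"
    using assms(4,12) by blast
  note k0 = subfieldD[OF fixed_centre_subfield]
  interpret D: galois_self_centralizing_subfield B L us bs
  proof (intro galois_self_centralizing_subfield.intro based_self_centralizing_subfield.intro
      self_centralizing_subfield.intro skew_field_axioms self_centralizing_subfield_axioms.intro
      based_self_centralizing_subfield_axioms.intro galois_self_centralizing_subfield_axioms.intro
      L us(2) us_Span bs(2,4) galL)
    show "x \<in> L" if "x \<in> carrier B" "\<And>l. l \<in> L \<Longrightarrow> l \<otimes> x = x \<otimes> l" for x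
      using L_self_centralizing that .
    show "add_pow B m \<one> \<noteq> \<zero>" if "0 < m" for m :: nat
      using field_ordering_char_zero[OF P(1) k0(1,3) one_not_zero that] .
  qed
  \<comment> \<open>Positivity is stated for the degree \<open>n\<close>, the trace lemmas for the
    dimension of \<open>B\<close> over \<open>L\<close>; they must be identified before positivity
    can be used.\<close>
  have "n\<^sup>2 = (length us)\<^sup>2" using D.degree_square bs(3) by simp
  then have n: "n = length us" by simp
  interpret Q: positive_galois_subfield B L us bs \<tau> P
  proof (intro positive_galois_subfield.intro positive_galois_subfield_axioms.intro
      D.galois_self_centralizing_subfield_axioms skew_field_involution_axioms P(1))
    show "reduced_trace B (length us) (\<tau> x \<otimes> x) \<in> P - {\<zero>}" if "x \<in> carrier B" "x \<noteq> \<zero>" for x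
      using P(2) that unfolding positive_involution_def n by blast
  qed (rule tau_L)
  note L0 = L0_props
  have L0c: "x \<in> L\<^sub>0 \<longleftrightarrow> x \<in> L \<and> \<tau> x = x" for x
    using L_Sym subfieldD(4)[OF L(1)] unfolding Sym_def by blast
  have restrict_aut: "\<phi> \<in> field_auts B k\<^sub>0 L\<^sub>0" if \<phi>: "\<phi> \<in> field_auts B (centre B) L" for \<phi>
  proof (rule field_autsI)
    note f = field_autsD[OF \<phi>]
    show L0_closed: "\<phi> x \<in> L\<^sub>0" if "x \<in> L\<^sub>0" for x
      using that f(1) Q.aut_commutes_tau[OF \<phi>, of x] by (simp add: L0c)
    show "\<phi> (x \<oplus> y) = \<phi> x \<oplus> \<phi> y" "\<phi> (x \<otimes> y) = \<phi> x \<otimes> \<phi> y" if "x \<in> L\<^sub>0" "y \<in> L\<^sub>0" for x y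
      using f(2,3) L0(3) that by simp_all
    show "\<phi> \<one> = \<one>" by (rule f(4))
    show "\<phi> x = x" if "x \<in> k\<^sub>0" for x
      using f(5) that unfolding assms(4) fixed_centre_def by blast
    \<comment> \<open>Surjectivity on \<open>L\<^sub>0\<close>: if \<open>y\<close> in
      \<open>L\<close> maps to a symmetric element, then so does \<open>\<tau> y\<close>, to the
      same one, and injectivity makes \<open>y\<close> symmetric.\<close>
    have "x \<in> \<phi> ` L\<^sub>0" if x: "x \<in> L\<^sub>0" for x
    proof -
      have "x \<in> \<phi> ` L" using bij_betw_imp_surj_on[OF f(6)] L0(3)[OF x] by simp
      then obtain y where y: "x = \<phi> y" "y \<in> L" by (rule imageE)
      have "\<phi> (\<tau> y) = \<phi> y" using Q.aut_commutes_tau[OF \<phi> y(2)] y(1) L0(5)[OF x] by simp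
      then have "\<tau> y = y" by (rule inj_onD[OF bij_betw_imp_inj_on[OF f(6)] _ tau_L[OF y(2)] y(2)])
      then show ?thesis using y L0c by simp
    qed
    moreover have "inj_on \<phi> L\<^sub>0"
      by (rule inj_on_subset[OF bij_betw_imp_inj_on[OF f(6)]]) (rule subsetI, rule L0(3))
    ultimately show "bij_betw \<phi> L\<^sub>0 L\<^sub>0"
      using L0_closed by (intro bij_betw_imageI) auto
  qed
  \<comment> \<open>The restrictions from \<open>L\<close> already suffice: what they all fix is
    central, and its symmetric part is \<open>k\<^sub>0\<close>.\<close>
  have "x \<in> k\<^sub>0" if x: "x \<in> L\<^sub>0" and fixed: "\<forall>\<phi>\<in>field_auts B k\<^sub>0 L\<^sub>0. \<phi> x = x" for x
  proof -
    have "x \<in> centre B"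
      by (rule D.fixed_field[OF L0(3)[OF x]]) (rule bspec[OF fixed restrict_aut])
    then show ?thesis using L0(5)[OF x] assms(4) by (simp add: fixed_centre_def)
  qed
  moreover have "\<phi> x = x" if "x \<in> k\<^sub>0" "\<phi> \<in> field_auts B k\<^sub>0 L\<^sub>0" for x \<phi>
    by (rule field_autsD(5)[OF that(2,1)])
  moreover have k0_L0: "k\<^sub>0 \<subseteq> L\<^sub>0" using L0(2) unfolding assms(4) .
  ultimately have "{x \<in> L\<^sub>0. \<forall>\<phi>\<in>field_auts B k\<^sub>0 L\<^sub>0. \<phi> x = x} = k\<^sub>0"
    by (intro equalityI subsetI) (auto simp only: mem_Collect_eq)
  moreover have "\<forall>x\<in>L\<^sub>0. (algebraic over k\<^sub>0) x"
    using algebraic_over_fixed_centre alg L0(3) unfolding assms(4) by metis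
  ultimately show ?thesis
    unfolding galois_extension_def
    using L0(1) k0_L0 fixed_centre_subfield[folded assms(4)] by (intro conjI)
qed

end
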